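(* There exist functions $C_1,C_2,C_3:(0,\infty)\to(0,\infty)$ such that the following holds. Let $d\in\{1,2,3\}$, $\nu>0$, $\tau>0$ and let $N\ge 2$ be an integer. Assume $u_0\in H^1(\mathbb T^d)$ is real-valued and has mean zero, and let $(u^n)_{n\ge 0}$ be the numerical solution of the semi-implicit scheme $$\frac{u^{n+1}-u^n}{\tau}=-\nu\Delta^2u^{n+1}+\Delta\Pi_N(f(u^n)),\quad n\ge 0,\qquad u^0=\Pi_Nu_0 .$$ Assume $\|u^0\|_{L^\infty(\mathbb T^d)}=L_0<\infty$ with $L_0\neq 0$, and put $E_0=\mathcal E(u^0)$. If $$0<\tau\le\tau_{\max}=\min\Big\{\frac{8\nu}{9L_0^4},\ \tau_{\max}^{(1)}\Big\},\qquad \tau_{\max}^{(1)}=\begin{cases}C_1(E_0)\,\nu^{5/3},& d=1,\\ C_2(E_0)\,\nu^{3},& d=2,\\ C_3(E_0)\,\nu^{7},& d=3,\end{cases}$$ then $\mathcal E(u^{n+1})\le\mathcal E(u^n)$ for all $n\ge 0$.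
   Context: $\mathbb T^d=\mathbb R^d/\mathbb Z^d=[-\frac12,\frac12)^d$ is the $1$-periodic torus. $f(u)=u^3-u$. The energy is $$\mathcal E(u)=\int_{\mathbb T^d}\Big(\tfrac12\nu|\nabla u|^2+\tfrac14(u^2-1)^2\Big)dx .$$ Fourier convention: $\hat g(k)=\int_{\mathbb T^d}g(x)e^{-2\pi i k\cdot x}dx$, $g(x)=\sum_{k\in\mathbb Z^d}\hat g(k)e^{2\pi i k\cdot x}$. $\Pi_N$ is the $L^2$-projection onto $X_N=\operatorname{Span}\{\cos(2\pi k\cdot x),\sin(2\pi k\cdot x):k\in\mathbb Z^d,\ |k|_\infty\le N\}$, where $|k|_\infty=\max_j|k_j|$; i.e. $\Pi_N$ truncates to Fourier modes with $|k|_\infty\le N$. Each $u^{n+1}\in X_N$ is uniquely determined by $u^n$ through the scheme. *)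

theory Defs
  imports "HOL-Analysis.Analysis" "HOL-Probability.Essential_Supremum"
begin

text \<open>
  Functions on the torus are 1-periodic functions on \<open>real ^ 'd\<close>; integrals over the torus
  are integrals over the fundamental cell.
\<close>

definition cell :: "(real ^ 'd) set" where
  "cell = {x. \<forall>i. - 1/2 \<le> x $ i \<and> x $ i < 1/2}"

definition periodic :: "(real ^ 'd \<Rightarrow> real) \<Rightarrow> bool" where
  "periodic g \<longleftrightarrow> (\<forall>x i. g (x + axis i 1) = g x)"

definition freq_dot :: "int ^ 'd \<Rightarrow> real ^ 'd \<Rightarrow> real" where
  "freq_dot k x = (\<Sum>i\<in>UNIV. of_int (k $ i) * x $ i)"

definition fourier :: "(real ^ 'd \<Rightarrow> real) \<Rightarrow> int ^ 'd \<Rightarrow> complex" where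
  "fourier g k = (LINT x:cell|lebesgue. complex_of_real (g x) * cis (- 2 * pi * freq_dot k x))"

definition freq_norm_inf :: "int ^ 'd \<Rightarrow> int" where
  "freq_norm_inf k = Max (range (\<lambda>i. \<bar>k $ i\<bar>))"

definition modes :: "nat \<Rightarrow> (int ^ 'd) set" where
  "modes N = {k. freq_norm_inf k \<le> int N}"

text \<open>The real linear span of the cosines and sines with frequencies in \<open>modes N\<close>.\<close>

definition trig_space :: "nat \<Rightarrow> (real ^ 'd \<Rightarrow> real) set" where
  "trig_space N = {g. \<exists>a b. g = (\<lambda>x. \<Sum>k\<in>modes N.
      a k * cos (2 * pi * freq_dot k x) + b k * sin (2 * pi * freq_dot k x))}"

text \<open>
  Fourier truncation.  For real \<open>g\<close> the truncated Fourier series is itself real, so \<open>Re\<close> is only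
  a change of type; see \<open>of_real_proj\<close> below.
\<close>

definition proj :: "nat \<Rightarrow> (real ^ 'd \<Rightarrow> real) \<Rightarrow> real ^ 'd \<Rightarrow> real" where
  "proj N g x = Re (\<Sum>k\<in>modes N. fourier g k * cis (2 * pi * freq_dot k x))"

text \<open>
  The Sobolev space \<open>H\<^sup>1\<close> of the torus: square integrable functions for which the sum of
  \<open>(1 + |k|\<^sup>2) |fourier g k|\<^sup>2\<close> over all frequencies is finite.
\<close>

definition sobolev_H1 :: "(real ^ 'd \<Rightarrow> real) set" where
  "sobolev_H1 = {g. periodic g
     \<and> set_borel_measurable lebesgue cell g
     \<and> set_integrable lebesgue cell (\<lambda>x. (g x)\<^sup>2)
     \<and> (\<lambda>k. (1 + (\<Sum>i\<in>UNIV. (of_int (k $ i))\<^sup>2)) * (cmod (fourier g k))\<^sup>2) summable_on UNIV}"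

definition mean_zero :: "(real ^ 'd \<Rightarrow> real) \<Rightarrow> bool" where
  "mean_zero g \<longleftrightarrow> (LINT x:cell|lebesgue. g x) = 0"

definition Linf_norm :: "(real ^ 'd \<Rightarrow> real) \<Rightarrow> ereal" where
  "Linf_norm g = esssup (lebesgue_on cell) (\<lambda>x. ereal \<bar>g x\<bar>)"

text \<open>
  Classical partial derivatives; they are only ever applied to trigonometric polynomials.
\<close>

definition partial :: "'d \<Rightarrow> (real ^ 'd \<Rightarrow> real) \<Rightarrow> real ^ 'd \<Rightarrow> real" where
  "partial i g x = deriv (\<lambda>t. g (x + t *\<^sub>R axis i 1)) 0"

definition grad :: "(real ^ 'd \<Rightarrow> real) \<Rightarrow> real ^ 'd \<Rightarrow> real ^ 'd" where
  "grad g x = (\<chi> i. partial i g x)"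

definition laplacian :: "(real ^ 'd \<Rightarrow> real) \<Rightarrow> real ^ 'd \<Rightarrow> real" where
  "laplacian g x = (\<Sum>i\<in>UNIV. partial i (partial i g) x)"

definition nonlin :: "real \<Rightarrow> real" where
  "nonlin s = s ^ 3 - s"

definition energy :: "real \<Rightarrow> (real ^ 'd \<Rightarrow> real) \<Rightarrow> real" where
  "energy \<nu> g = (LINT x:cell|lebesgue.
     1/2 * \<nu> * (norm (grad g x))\<^sup>2 + 1/4 * ((g x)\<^sup>2 - 1)\<^sup>2)"

definition scheme_solution ::
  "real \<Rightarrow> real \<Rightarrow> nat \<Rightarrow> (real ^ 'd \<Rightarrow> real) \<Rightarrow> (nat \<Rightarrow> real ^ 'd \<Rightarrow> real) \<Rightarrow> bool" where
  "scheme_solution \<nu> \<tau> N u0 u \<longleftrightarrow>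
     u 0 = proj N u0 \<and>
     (\<forall>n. u (Suc n) \<in> trig_space N \<and>
        (\<forall>x. (u (Suc n) x - u n x) / \<tau> =
              - \<nu> * laplacian (laplacian (u (Suc n))) x
              + laplacian (proj N (\<lambda>y. nonlin (u n y))) x))"

lemma freq_norm_inf_uminus: "freq_norm_inf (- k) = freq_norm_inf k"
  by (simp add: freq_norm_inf_def)

lemma cnj_fourier: "cnj (fourier g k) = fourier g (- k)"
proof -
  have "cnj (fourier g k) =
      (\<integral>x. cnj (indicator cell x *\<^sub>R (complex_of_real (g x) * cis (- 2 * pi * freq_dot k x))) \<partial>lebesgue)"
    by (simp add: fourier_def set_lebesgue_integral_def del: complex_cnj_scaleR complex_cnj_mult)
  also have "\<dots> = fourier g (- k)"
    by (simp add: fourier_def set_lebesgue_integral_def freq_dot_def cis_cnj sum_negf)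
  finally show ?thesis .
qed

lemma of_real_proj:
  "complex_of_real (proj N g x) = (\<Sum>k\<in>modes N. fourier g k * cis (2 * pi * freq_dot k x))"
proof -
  let ?S = "\<Sum>k\<in>modes N. fourier g k * cis (2 * pi * freq_dot k x)"
  have "cnj ?S = (\<Sum>k\<in>modes N. fourier g (- k) * cis (2 * pi * freq_dot (- k) x))"
    by (simp add: cnj_fourier cis_cnj freq_dot_def sum_negf)
  also have "\<dots> = ?S"
    by (rule sum.reindex_bij_witness[of _ uminus uminus])
      (auto simp: modes_def freq_norm_inf_uminus)
  finally have "?S \<in> \<real>" by (simp add: Reals_cnj_iff)
  then show ?thesis by (simp only: proj_def of_real_Re)
qed

end

theory Submission
  imports Defs
begin

text \<open>
  Write \<open>a = u n\<close>, \<open>b = u (Suc n)\<close>, \<open>e = b - a\<close>, and let \<open>\<lambda>\<close> range over the eigenvalues \<open>(2 \<pi>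
  |k|)\<^sup>2\<close> of minus the Laplacian. Testing the scheme with the inverse of \<open>- \<Delta>\<close> applied to \<open>e\<close>,
  which makes sense because the scheme preserves the mean, and expanding the double well to fourth
  order around \<open>a\<close> gives \<open>E(b) - E(a) \<le> - D + 2 \<integral>a\<^sup>2 e\<^sup>2 + (3/4) \<integral>e\<^sup>4\<close>, where the dissipation is
  \<open>D = \<Sum> (1 / (\<lambda> \<tau>) + \<nu> \<lambda> / 2) |e\<^sub>k|\<^sup>2\<close>. So it suffices that \<open>D\<close> absorbs the two integrals. The
  energy itself bounds \<open>\<integral>a\<^sup>4\<close>, and the Cauchy-Schwarz inequality reduces everything to \<open>z\<close>, the
  square of the \<open>L\<^sup>4\<close> norm of \<open>e\<close>.

  The critical Sobolev embedding of \<open>H\<^bsup>d/4\<^esup>\<close> into \<open>L\<^sup>4\<close> (\<open>critical_sobolev_L4\<close>) bounds \<open>z\<close> by a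
  constant times \<open>\<Sum> |k|\<^bsup>d/2\<^esup> |e\<^sub>k|\<^sup>2\<close>. When \<open>d < 4\<close>, the exponent \<open>d/2\<close> lies strictly between the
  exponents \<open>-2\<close> and \<open>2\<close> of the two parts of the dissipation, and \<open>\<tau> \<le> \<epsilon> (\<epsilon> \<nu>)\<^bsup>(4+d)/(4-d)\<^esup>\<close>
  ensures that the weight \<open>|k|\<^bsup>d/2\<^esup>\<close> is at most \<open>\<epsilon> (1 / (\<lambda> \<tau>) + \<nu> \<lambda>)\<close> at every frequency
  (\<open>interpolation_powr\<close>); the exponent is \<open>5/3\<close>, \<open>3\<close>, \<open>7\<close> for \<open>d = 1, 2, 3\<close>. Hence \<open>z \<le> \<eta> D\<close> with
  \<open>\<eta>\<close> proportional to \<open>\<epsilon>\<close> (\<open>L4_le_dissipation\<close>).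

  The quartic term \<open>z\<^sup>2 \<le> \<eta>\<^sup>2 D\<^sup>2\<close> is only harmless once \<open>D\<close> is known to be bounded. That bound
  comes from the same tested equation, estimating \<open>\<integral>f(a) e\<close> with \<open>f(a) e = (a\<^sup>2 - 1) (a e)\<close> by the
  potential energy of \<open>a\<close> and \<open>\<integral>a\<^sup>2 e\<^sup>2\<close>: it yields \<open>D \<le> 3 E\<close>. Taking \<open>\<eta>\<close> of the order \<open>(8 E +
  2)\<^bsup>-1/2\<^esup>\<close> closes the step (\<open>absorption\<close>, \<open>energy_step\<close>), and since the energy does not grow, the
  initial energy can serve as \<open>E\<close> at all steps.
\<close>

section \<open>Integration over the unit cell\<close>

lemma cell_eq_Basis: "cell = {x :: real ^ 'd. \<forall>b\<in>Basis. - 1/2 \<le> x \<bullet> b \<and> x \<bullet> b < 1/2}"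
  by (auto simp: cell_def Basis_vec_def inner_axis)

lemma sets_cell [measurable]: "cell \<in> sets (borel :: (real ^ 'd) measure)"
proof -
  have "{x :: real ^ 'd. x \<in> space borel \<and> (\<forall>b\<in>Basis. - 1/2 \<le> x \<bullet> b \<and> x \<bullet> b < 1/2)} \<in> sets borel"
    by measurable
  then show ?thesis by (simp add: cell_eq_Basis)
qed

text \<open>
  Every integrand below is continuous, so integrability reduces to compactness of the closed cube.
\<close>

lemma integrable_cell:
  fixes f :: "real ^ 'd \<Rightarrow> 'b :: {banach, second_countable_topology}"
  assumes "continuous_on UNIV f"
  shows "set_integrable lebesgue cell f"
proof -
  define K :: "(real ^ 'd) set" where "K = cbox (\<chi> i. - 1/2) (\<chi> i. 1/2)"
  have f [measurable]: "f \<in> borel_measurable borel"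
    using assms by (rule borel_measurable_continuous_onI)
  have "integrable lborel (\<lambda>x. indicator K x *\<^sub>R f x)"
    unfolding K_def
    by (intro borel_integrable_compact compact_cbox continuous_on_subset[OF assms]) auto
  then have "set_integrable lborel K f"
    by (simp add: set_integrable_def)
  moreover have "cell \<subseteq> K"
    by (auto simp: K_def cell_def mem_box Basis_vec_def inner_axis less_imp_le)
  ultimately have "set_integrable lborel cell f"
    by (intro set_integrable_subset[of lborel K f cell]) auto
  then show ?thesis
    unfolding set_integrable_def by (subst integrable_completion) auto
qed

lemma cell_integral_lborel:
  fixes f :: "real ^ 'd \<Rightarrow> 'b :: {banach, second_countable_topology}"
  assumes "continuous_on UNIV f"
  shows "(LINT x:cell|lebesgue. f x) = (LINT x|lborel. indicator cell x *\<^sub>R f x)"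
proof -
  have [measurable]: "f \<in> borel_measurable borel"
    using assms by (rule borel_measurable_continuous_onI)
  show ?thesis
    unfolding set_lebesgue_integral_def by (rule integral_completion) auto
qed

text \<open>
  The one-dimensional factor of the orthogonality relation. The integral over the half-open
  interval equals that over the closed one, where the fundamental theorem of calculus applies.
\<close>

lemma integral_cis_period:
  "(LINT t|lborel. indicator {-(1/2)..<1/2::real} t *\<^sub>R cis (2 * pi * of_int n * t))
     = (if n = 0 then 1 else 0)"
  "integrable lborel (\<lambda>t. indicator {-(1/2)..<1/2::real} t *\<^sub>R cis (2 * pi * of_int n * t))"
proof -
  let ?f = "\<lambda>t::real. cis (2 * pi * of_int n * t)"
  have cont: "continuous_on A ?f" for A
    by (intro continuous_intros)
  then have [measurable]: "?f \<in> borel_measurable borel"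
    by (intro borel_measurable_continuous_onI)
  have ae: "AE t in lborel. indicator {-(1/2)..<1/2::real} t *\<^sub>R ?f t
      = indicator {-(1/2)..1/2} t *\<^sub>R ?f t"
    using AE_lborel_singleton[of "1/2::real"] by eventually_elim (auto simp: indicator_def)
  have "integrable lborel (\<lambda>t. indicator {-(1/2)..1/2::real} t *\<^sub>R ?f t)"
    by (intro borel_integrable_compact cont compact_Icc)
  then show "integrable lborel (\<lambda>t. indicator {-(1/2)..<1/2::real} t *\<^sub>R ?f t)"
    using ae by (subst integrable_cong_AE[OF _ _ ae]) auto
  have eq: "(LINT t|lborel. indicator {-(1/2)..<1/2::real} t *\<^sub>R ?f t)
      = (LINT t|lborel. indicator {-(1/2)..1/2::real} t *\<^sub>R ?f t)"
    using ae by (intro integral_cong_AE) auto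
  show "(LINT t|lborel. indicator {-(1/2)..<1/2::real} t *\<^sub>R ?f t) = (if n = 0 then 1 else 0)"
  proof (cases "n = 0")
    case True
    have "(LINT t|lborel. indicator {-(1/2)..1/2::real} t *\<^sub>R (1::complex)) = 1"
      by (simp del: scaleR_one add: scaleR_conv_of_real)
    with True show ?thesis unfolding eq by simp
  next
    case False
    let ?w = "2 * pi * of_int n"
    have der: "((\<lambda>t. cis (?w * t) / (\<i> * of_real ?w)) has_vector_derivative ?f t)
        (at t within {-(1/2)..1/2})" for t
    proof -
      have "((\<lambda>z. exp (\<i> * of_real ?w * z) / (\<i> * of_real ?w)) has_field_derivative
          exp (\<i> * of_real ?w * of_real t)) (at (of_real t))"
        using False by (auto intro!: derivative_eq_intros)
      from has_vector_derivative_real_field[OF this] show ?thesis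
        by (simp add: cis_conv_exp mult.assoc)
    qed
    have "(LINT t|lborel. indicator {-(1/2)..1/2::real} t *\<^sub>R ?f t)
        = cis (?w * (1/2)) / (\<i> * of_real ?w) - cis (?w * (- (1/2))) / (\<i> * of_real ?w)"
      by (rule integral_FTC_atLeastAtMost) (use der cont in auto)
    also have "cis (?w * (- (1/2))) = cis (?w * (1/2))"
    proof -
      have "sin (pi * of_int n) = 0" by (simp add: sin_zero_iff_int2)
      then show ?thesis by (simp add: complex_eq_iff mult.commute)
    qed
    finally show ?thesis unfolding eq using False by simp
  qed
qed

lemma freq_dot_Basis: "freq_dot k x = (\<Sum>b\<in>Basis. ((\<chi> i. of_int (k $ i)) \<bullet> b) * (x \<bullet> b))"
  unfolding euclidean_inner[symmetric] by (simp add: freq_dot_def inner_vec_def)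

lemma continuous_on_freq_dot [continuous_intros]: "continuous_on A (freq_dot k)"
  unfolding freq_dot_def by (intro continuous_intros)

text \<open>
  Orthogonality of the characters: Lebesgue measure on \<open>real ^ 'd\<close> is the image of a product measure
  and the integrand, including the indicator of the cell, is a product over the coordinates.
\<close>

lemma integral_character:
  fixes k :: "int ^ 'd"
  shows "(LINT x:cell|lebesgue. cis (2 * pi * freq_dot k x)) = (if k = 0 then 1 else 0)"
proof -
  \<comment> \<open>The coordinates of \<open>k\<close>, indexed by basis vectors instead of indices, as in the product measure.\<close>
  define n where "n b = k $ (SOME i. b = axis i 1)" for b :: "real ^ 'd"
  have n_axis: "n (axis i 1) = k $ i" for i
  proof -
    have "(SOME j. (axis i 1 :: real ^ 'd) = axis j 1) = i"
      by (rule some_equality) (auto simp: axis_eq_axis)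
    then show ?thesis by (simp add: n_def)
  qed
  have kn: "(\<chi> i. of_int (k $ i)) \<bullet> b = (of_int (n b) :: real)" if "b \<in> Basis" for b
    using that by (auto simp: Basis_vec_def inner_axis n_axis)
  define f where "f b t = indicator {-(1/2)..<1/2::real} t *\<^sub>R cis (2 * pi * of_int (n b) * t)"
    for b :: "real ^ 'd" and t
  have [measurable]: "f b \<in> borel_measurable borel" for b
    using borel_measurable_integrable[OF integral_cis_period(2)[of "n b"]] by (simp add: f_def[abs_def])
  have cis_sum: "cis (\<Sum>b\<in>A. g b) = (\<Prod>b\<in>A. cis (g b))" if "finite A"
    for A :: "(real ^ 'd) set" and g
    using that by (induction A rule: finite_induct) (auto simp: cis_mult[symmetric])
  have ind: "indicator cell x = (\<Prod>b\<in>Basis. indicator {-(1/2)..<1/2::real} (x \<bullet> b) :: real)"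
    for x :: "real ^ 'd"
    by (auto simp: cell_eq_Basis indicator_def prod_zero_iff)
  have prod: "indicator cell x *\<^sub>R cis (2 * pi * freq_dot k x) = (\<Prod>b\<in>Basis. f b (x \<bullet> b))"
    for x :: "real ^ 'd"
  proof -
    have "2 * pi * freq_dot k x = (\<Sum>b\<in>Basis. 2 * pi * of_int (n b) * (x \<bullet> b))"
      by (simp add: freq_dot_Basis sum_distrib_left kn mult.assoc)
    then show ?thesis
      by (simp add: f_def ind cis_sum scaleR_conv_of_real prod.distrib)
  qed
  interpret product_sigma_finite "\<lambda>_. lborel :: real measure" ..
  have "(LINT x:cell|lebesgue. cis (2 * pi * freq_dot k x))
      = (LINT x|lborel. (\<Prod>b\<in>Basis. f b (x \<bullet> b)))"
    by (subst cell_integral_lborel) (simp_all add: prod continuous_intros)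
  also have "\<dots> = (LINT x|(\<Pi>\<^sub>M b\<in>Basis. lborel). (\<Prod>b\<in>Basis. f b (x b)))"
    by (subst lborel_eq, subst integral_distr) (auto simp: inner_sum_left inner_Basis if_distrib cong: prod.cong if_cong)
  also have "\<dots> = (\<Prod>b\<in>Basis. LINT t|lborel. f b t)"
    by (rule product_integral_prod) (auto simp: f_def[abs_def] integral_cis_period(2))
  also have "\<dots> = (\<Prod>b\<in>Basis. if n b = 0 then 1 else 0)"
    by (simp add: f_def integral_cis_period(1))
  also have "\<dots> = (if k = 0 then 1 else 0)"
    by (auto simp: prod_zero_iff vec_eq_iff n_axis[symmetric] Basis_vec_def intro!: prod.neutral)
  finally show ?thesis .
qed

lemma integral_cell_const: "(LINT x:(cell :: (real ^ 'd) set)|lebesgue. (r :: real)) = r"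
proof -
  have "(LINT x:(cell :: (real ^ 'd) set)|lebesgue. (1 :: complex)) = 1"
    using integral_character[of "0 :: int ^ 'd"] by (simp add: freq_dot_def)
  then have "Re (LINT x:(cell :: (real ^ 'd) set)|lebesgue. (1 :: complex)) = 1" by simp
  moreover have "set_integrable lebesgue (cell :: (real ^ 'd) set) (\<lambda>x. 1 :: complex)"
    by (intro integrable_cell continuous_intros)
  ultimately have "(LINT x:(cell :: (real ^ 'd) set)|lebesgue. (1 :: real)) = 1"
    unfolding set_lebesgue_integral_def set_integrable_def by (subst (asm) integral_Re[symmetric]) auto
  then show ?thesis
    using set_integral_mult_right[where a = r, of lebesgue "cell :: (real ^ 'd) set" "\<lambda>_. 1 :: real"]
      integrable_cell[of "\<lambda>_ :: real ^ 'd. 1 :: real"] by simp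
qed

lemma integral_cell_nonneg:
  fixes f :: "real ^ 'd \<Rightarrow> real"
  assumes "\<And>x. 0 \<le> f x"
  shows "0 \<le> (LINT x:cell|lebesgue. f x)"
  unfolding set_lebesgue_integral_def using assms by (intro Bochner_Integration.integral_nonneg) auto

lemma integral_cell_mono:
  fixes f g :: "real ^ 'd \<Rightarrow> real"
  assumes "continuous_on UNIV f" "continuous_on UNIV g" "\<And>x. f x \<le> g x"
  shows "(LINT x:cell|lebesgue. f x) \<le> (LINT x:cell|lebesgue. g x)"
  using assms by (intro set_integral_mono integrable_cell)

lemma integral_cell_linear:
  fixes f g :: "real ^ 'd \<Rightarrow> real"
  assumes "continuous_on UNIV f" "continuous_on UNIV g"
  shows "(LINT x:cell|lebesgue. r * f x + s * g x)
    = r * (LINT x:cell|lebesgue. f x) + s * (LINT x:cell|lebesgue. g x)"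
  by (subst set_integral_add) (auto intro!: integrable_cell continuous_intros assms)

text \<open>
  The usual discriminant argument, applied to the nonnegative quadratic polynomial
  \<open>t \<mapsto> \<integral>(t f - g)\<^sup>2\<close>.
\<close>

lemma cauchy_schwarz_cell:
  fixes f g :: "real ^ 'd \<Rightarrow> real"
  assumes f: "continuous_on UNIV f" and g: "continuous_on UNIV g"
  shows "(LINT x:cell|lebesgue. f x * g x)
    \<le> sqrt (LINT x:cell|lebesgue. (f x)\<^sup>2) * sqrt (LINT x:cell|lebesgue. (g x)\<^sup>2)"
proof -
  define F where "F = (LINT x:cell|lebesgue. (f x)\<^sup>2)"
  define G where "G = (LINT x:cell|lebesgue. (g x)\<^sup>2)"
  define P where "P = (LINT x:cell|lebesgue. f x * g x)"
  have FG: "F \<ge> 0" "G \<ge> 0" by (auto simp: F_def G_def intro: integral_cell_nonneg)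
  have quad: "2 * t * P \<le> t\<^sup>2 * F + G" for t
  proof -
    have "0 \<le> (LINT x:cell|lebesgue. (t * f x - g x)\<^sup>2)"
      by (rule integral_cell_nonneg) simp
    also have "\<dots> = (LINT x:cell|lebesgue. 1 * (t\<^sup>2 * (f x)\<^sup>2 + 1 * (g x)\<^sup>2) + (- 2 * t) * (f x * g x))"
      by (simp add: power2_diff power_mult_distrib mult_ac)
    also have "\<dots> = t\<^sup>2 * F + G - 2 * t * P"
      by (subst integral_cell_linear, (intro continuous_intros f g)+)+
        (simp add: F_def G_def P_def)
    finally show ?thesis by simp
  qed
  have "P\<^sup>2 \<le> F * G \<or> P \<le> 0"
  proof (cases "F = 0")
    case True
    have "\<not> P > 0"
    proof
      assume "P > 0"
      with quad[of "(G + 1) / P"] True FG show False by simp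
    qed
    then show ?thesis by simp
  next
    case False
    with FG quad[of "P / F"] show ?thesis by (simp add: power2_eq_square field_simps)
  qed
  then have "P \<le> sqrt (F * G)"
  proof
    assume "P \<le> 0"
    also have "0 \<le> sqrt (F * G)" using FG by simp
    finally show ?thesis .
  qed (rule real_le_rsqrt)
  then show ?thesis by (simp add: P_def F_def G_def real_sqrt_mult)
qed

section \<open>Real trigonometric polynomials and their Fourier coefficients\<close>

lemma mem_modes: "k \<in> modes N \<longleftrightarrow> (\<forall>i. \<bar>k $ i\<bar> \<le> int N)"
  by (auto simp: modes_def freq_norm_inf_def)

lemma modes_eq_PiE: "modes N = vec_lambda ` (\<Pi>\<^sub>E i\<in>UNIV. {- int N..int N})"
proof (intro equalityI subsetI)
  fix k :: "int ^ 'd" assume "k \<in> modes N"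
  then have "vec_nth k \<in> (\<Pi>\<^sub>E i\<in>UNIV. {- int N..int N})"
    by (auto simp: mem_modes abs_le_iff minus_le_iff)
  then show "k \<in> vec_lambda ` (\<Pi>\<^sub>E i\<in>UNIV. {- int N..int N})"
    by (metis image_eqI vec_nth_inverse)
qed (auto simp: mem_modes PiE_def Pi_def abs_le_iff minus_le_iff)

lemma finite_modes [simp]: "finite (modes N)"
  by (simp add: modes_eq_PiE finite_PiE)

lemma card_modes: "card (modes N :: (int ^ 'd) set) = (2 * N + 1) ^ CARD('d)"
proof -
  have "inj_on (vec_lambda :: _ \<Rightarrow> int ^ 'd) A" for A
    by (simp add: inj_on_def vec_lambda_inject)
  then show ?thesis
    by (simp add: modes_eq_PiE card_image card_PiE nat_add_distrib nat_mult_distrib algebra_simps)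
qed

lemma uminus_mem_modes [simp]: "- k \<in> modes N \<longleftrightarrow> k \<in> modes N"
  by (simp add: mem_modes)

lemma sum_modes_uminus: "(\<Sum>k\<in>modes N. f (- k)) = (\<Sum>k\<in>modes N. f k)"
  by (rule sum.reindex_bij_witness[of _ uminus uminus]) auto

lemma freq_dot_uminus: "freq_dot (- k) x = - freq_dot k x"
  by (simp add: freq_dot_def sum_negf)

lemma freq_dot_diff: "freq_dot (j - k) x = freq_dot j x - freq_dot k x"
  by (simp add: freq_dot_def sum_subtractf left_diff_distrib)

text \<open>
  Taking the real part keeps the values real for arbitrary coefficients, so that sums, multiples and
  derivatives can be computed before any symmetry is checked. For Hermitian coefficients the real
  part removes nothing (\<open>of_real_trig_poly\<close>), and only these are determined by the function.
\<close>

definition trig_poly :: "nat \<Rightarrow> (int ^ 'd \<Rightarrow> complex) \<Rightarrow> real ^ 'd \<Rightarrow> real" where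
  "trig_poly N c x = Re (\<Sum>k\<in>modes N. c k * cis (2 * pi * freq_dot k x))"

definition hermitian :: "(int ^ 'd \<Rightarrow> complex) \<Rightarrow> bool" where
  "hermitian c \<longleftrightarrow> (\<forall>k. c (- k) = cnj (c k))"

lemma of_real_trig_poly:
  assumes "hermitian c"
  shows "complex_of_real (trig_poly N c x) = (\<Sum>k\<in>modes N. c k * cis (2 * pi * freq_dot k x))"
proof -
  let ?S = "\<Sum>k\<in>modes N. c k * cis (2 * pi * freq_dot k x)"
  have "cnj ?S = (\<Sum>k\<in>modes N. c (- k) * cis (2 * pi * freq_dot (- k) x))"
    using assms by (simp add: hermitian_def cis_cnj freq_dot_uminus)
  also have "\<dots> = ?S"
    by (rule sum_modes_uminus)
  finally have "?S \<in> \<real>" by (simp add: Reals_cnj_iff)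
  then show ?thesis by (simp only: trig_poly_def of_real_Re)
qed

lemma continuous_on_trig_poly [continuous_intros]: "continuous_on A (trig_poly N c)"
  unfolding trig_poly_def by (intro continuous_intros)

lemma trig_poly_diff: "trig_poly N (\<lambda>k. c k - e k) x = trig_poly N c x - trig_poly N e x"
  by (simp add: trig_poly_def left_diff_distrib sum_subtractf)

lemma hermitian_fourier: "hermitian (fourier g)"
  by (simp add: hermitian_def cnj_fourier)

lemma hermitian_diff: "hermitian c \<Longrightarrow> hermitian e \<Longrightarrow> hermitian (\<lambda>k. c k - e k)"
  by (simp add: hermitian_def)

lemma hermitian_real_multiple:
  assumes "hermitian c" "\<And>k. r (- k) = r k"
  shows "hermitian (\<lambda>k. of_real (r k) * c k)"
  using assms by (simp add: hermitian_def)

lemma proj_eq_trig_poly: "proj N g = trig_poly N (fourier g)"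
  by (simp add: fun_eq_iff proj_def trig_poly_def)

lemma set_integral_sum:
  fixes f :: "'i \<Rightarrow> 'a \<Rightarrow> 'b :: {banach, second_countable_topology}"
  assumes "\<And>i. i \<in> I \<Longrightarrow> set_integrable M A (f i)"
  shows "(LINT x:A|M. (\<Sum>i\<in>I. f i x)) = (\<Sum>i\<in>I. LINT x:A|M. f i x)"
  using assms unfolding set_lebesgue_integral_def set_integrable_def
  by (simp add: scaleR_sum_right Bochner_Integration.integral_sum)

lemma fourier_trig_poly:
  assumes "hermitian c"
  shows "fourier (trig_poly N c) k = (if k \<in> modes N then c k else 0)"
proof -
  have "fourier (trig_poly N c) k
      = (LINT x:cell|lebesgue. (\<Sum>j\<in>modes N. c j * cis (2 * pi * freq_dot (j - k) x)))"
    unfolding fourier_def of_real_trig_poly[OF assms]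
    by (simp add: sum_distrib_right mult.assoc cis_mult freq_dot_diff right_diff_distrib)
  also have "\<dots> = (\<Sum>j\<in>modes N. LINT x:cell|lebesgue. c j * cis (2 * pi * freq_dot (j - k) x))"
    by (intro set_integral_sum integrable_cell continuous_intros)
  also have "\<dots> = (\<Sum>j\<in>modes N. c j * (if j = k then 1 else 0))"
    by (simp add: integral_character)
  also have "\<dots> = (if k \<in> modes N then c k else 0)"
    by (simp add: if_distrib cong: if_cong)
  finally show ?thesis .
qed

lemma trig_poly_cong_iff:
  fixes c e :: "int ^ 'd \<Rightarrow> complex"
  assumes "hermitian c" "hermitian e"
  shows "trig_poly N c = trig_poly N e \<longleftrightarrow> (\<forall>k\<in>modes N. c k = e k)"
proof
  assume *: "trig_poly N c = trig_poly N e"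
  show "\<forall>k\<in>modes N. c k = e k"
  proof
    fix k :: "int ^ 'd" assume "k \<in> modes N"
    then show "c k = e k"
      using fourier_trig_poly[OF assms(1), of N k] fourier_trig_poly[OF assms(2), of N k]
      by (simp add: *)
  qed
qed (auto simp: trig_poly_def fun_eq_iff intro!: arg_cong[where f = Re] sum.cong)

text \<open>
  Plancherel for a continuous function against a trigonometric polynomial. This is how the
  nonlinear term, whose spectrum is not contained in \<open>modes N\<close>, is tested with the increment.
\<close>

lemma integral_mult_trig_poly:
  assumes h: "continuous_on UNIV h"
  shows "(LINT x:cell|lebesgue. h x * trig_poly N c x)
    = (\<Sum>k\<in>modes N. Re (fourier h k * cnj (c k)))"
proof -
  let ?F = "\<lambda>k x. cnj (c k) * (complex_of_real (h x) * cis (- 2 * pi * freq_dot k x))"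
  have int: "set_integrable lebesgue cell (?F k)" for k
    by (intro integrable_cell continuous_intros h)
  have "h x * trig_poly N c x = Re (\<Sum>k\<in>modes N. ?F k x)" for x
  proof -
    have "trig_poly N c x = Re (cnj (\<Sum>k\<in>modes N. c k * cis (2 * pi * freq_dot k x)))"
      by (simp add: trig_poly_def)
    also have "\<dots> = Re (\<Sum>k\<in>modes N. cnj (c k) * cis (- 2 * pi * freq_dot k x))"
      by (simp add: cis_cnj)
    finally have "h x * trig_poly N c x
        = Re (of_real (h x) * (\<Sum>k\<in>modes N. cnj (c k) * cis (- 2 * pi * freq_dot k x)))"
      by simp
    then show ?thesis by (simp only: sum_distrib_left mult.left_commute)
  qed
  then have "(LINT x:cell|lebesgue. h x * trig_poly N c x)
      = (LINT x:cell|lebesgue. Re (\<Sum>k\<in>modes N. ?F k x))"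
    by simp
  also have "\<dots> = Re (LINT x:cell|lebesgue. (\<Sum>k\<in>modes N. ?F k x))"
  proof -
    have "set_integrable lebesgue cell (\<lambda>x. \<Sum>k\<in>modes N. ?F k x)"
      by (intro integrable_cell continuous_intros h)
    then show ?thesis
      unfolding set_lebesgue_integral_def set_integrable_def
      by (subst integral_Re[symmetric]) (auto simp del: Re_sum)
  qed
  also have "\<dots> = Re (\<Sum>k\<in>modes N. LINT x:cell|lebesgue. ?F k x)"
    by (subst set_integral_sum) (use int in auto)
  also have "\<dots> = (\<Sum>k\<in>modes N. Re (fourier h k * cnj (c k)))"
    by (simp only: set_integral_mult_right Re_sum fourier_def mult.commute)
  finally show ?thesis .
qed

lemma parseval:
  assumes "hermitian c"
  shows "(LINT x:cell|lebesgue. (trig_poly N c x)\<^sup>2) = (\<Sum>k\<in>modes N. (cmod (c k))\<^sup>2)"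
  unfolding power2_eq_square integral_mult_trig_poly[OF continuous_on_trig_poly]
  by (intro sum.cong refl) (simp add: fourier_trig_poly[OF assms] complex_mult_cnj cmod_def power2_eq_square)

text \<open>
  The frequencies \<open>k\<close> and \<open>- k\<close> span the same functions, so the coefficients of sines and cosines are
  not unique; averaging the two contributions produces Hermitian coefficients.
\<close>

lemma trig_space_imp_trig_poly:
  assumes "g \<in> trig_space N"
  shows "\<exists>c. hermitian c \<and> g = trig_poly N c"
proof -
  obtain a b where g: "g = (\<lambda>x. \<Sum>k\<in>modes N.
      a k * cos (2 * pi * freq_dot k x) + b k * sin (2 * pi * freq_dot k x))"
    using assms by (auto simp: trig_space_def)
  define z where "z k = Complex (a k) (- b k)" for k
  define c where "c k = (z k + cnj (z (- k))) / 2" for k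
  have "hermitian c"
    by (simp add: hermitian_def c_def add.commute)
  moreover have "g x = trig_poly N c x" for x
  proof -
    let ?e = "\<lambda>k. cis (2 * pi * freq_dot k x)"
    have "trig_poly N c x
        = (\<Sum>k\<in>modes N. Re (z k * ?e k) / 2) + (\<Sum>k\<in>modes N. Re (cnj (z (- k)) * ?e k) / 2)"
      by (simp add: trig_poly_def c_def distrib_right add_divide_distrib sum.distrib)
    also have "(\<Sum>k\<in>modes N. Re (cnj (z (- k)) * ?e k) / 2) = (\<Sum>k\<in>modes N. Re (cnj (z k) * ?e (- k)) / 2)"
      using sum_modes_uminus[of "\<lambda>k. Re (cnj (z (- k)) * ?e k) / 2"] by simp
    also have "\<dots> = (\<Sum>k\<in>modes N. Re (z k * ?e k) / 2)"
      by (simp add: freq_dot_uminus)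
    also have "(\<Sum>k\<in>modes N. Re (z k * ?e k) / 2) + (\<Sum>k\<in>modes N. Re (z k * ?e k) / 2) = g x"
      by (simp add: g z_def flip: sum.distrib)
    finally show ?thesis by simp
  qed
  ultimately show ?thesis by blast
qed

section \<open>Derivatives and the energy on the Fourier side\<close>

definition laplace_symbol :: "int ^ 'd \<Rightarrow> real" where
  "laplace_symbol k = (\<Sum>i\<in>UNIV. (2 * pi * of_int (k $ i))\<^sup>2)"

lemma laplace_symbol_uminus: "laplace_symbol (- k) = laplace_symbol k"
  by (simp add: laplace_symbol_def)

lemma laplace_symbol_nonneg: "0 \<le> laplace_symbol k"
  by (simp add: laplace_symbol_def sum_nonneg)

lemma laplace_symbol_0 [simp]: "laplace_symbol 0 = 0"
  by (simp add: laplace_symbol_def)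

lemma partial_trig_poly:
  "partial i (trig_poly N c) = trig_poly N (\<lambda>k. \<i> * of_real (2 * pi * of_int (k $ i)) * c k)"
proof
  fix x
  have shift: "freq_dot k (x + t *\<^sub>R axis i 1) = freq_dot k x + of_int (k $ i) * t" for k t
  proof -
    have "(\<Sum>j\<in>UNIV. of_int (k $ j) * (t *\<^sub>R axis i 1) $ j) = of_int (k $ i) * t"
      by (simp add: axis_def if_distrib cong: if_cong)
    then show ?thesis by (simp add: freq_dot_def distrib_left sum.distrib)
  qed
  have summand: "((\<lambda>t. Re (c k * cis (2 * pi * (freq_dot k x + of_int (k $ i) * t))))
      has_real_derivative
        Re (\<i> * of_real (2 * pi * of_int (k $ i)) * c k * cis (2 * pi * freq_dot k x))) (at 0)" for k
    by (auto intro!: derivative_eq_intros simp: algebra_simps)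
  have "((\<lambda>t. trig_poly N c (x + t *\<^sub>R axis i 1)) has_real_derivative
      trig_poly N (\<lambda>k. \<i> * of_real (2 * pi * of_int (k $ i)) * c k) x) (at 0)"
    unfolding trig_poly_def shift Re_sum by (intro DERIV_sum summand)
  then show "partial i (trig_poly N c) x
      = trig_poly N (\<lambda>k. \<i> * of_real (2 * pi * of_int (k $ i)) * c k) x"
    unfolding partial_def by (rule DERIV_imp_deriv)
qed

lemma laplacian_trig_poly:
  "laplacian (trig_poly N c) = trig_poly N (\<lambda>k. of_real (- laplace_symbol k) * c k)"
proof
  fix x
  have "laplacian (trig_poly N c) x = Re (\<Sum>i\<in>UNIV. \<Sum>k\<in>modes N.
      \<i> * of_real (2 * pi * of_int (k $ i)) * (\<i> * of_real (2 * pi * of_int (k $ i)) * c k)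
        * cis (2 * pi * freq_dot k x))"
    by (simp only: laplacian_def partial_trig_poly trig_poly_def Re_sum)
  also have "\<dots> = Re (\<Sum>k\<in>modes N. \<Sum>i\<in>UNIV.
      \<i> * of_real (2 * pi * of_int (k $ i)) * (\<i> * of_real (2 * pi * of_int (k $ i)) * c k)
        * cis (2 * pi * freq_dot k x))"
    by (subst sum.swap) simp
  also have "\<dots> = trig_poly N (\<lambda>k. of_real (- laplace_symbol k) * c k) x"
    unfolding trig_poly_def laplace_symbol_def of_real_minus of_real_sum sum_negf[symmetric] sum_distrib_right
    by (intro arg_cong[where f = Re] sum.cong refl) (simp add: power2_eq_square algebra_simps)
  finally show "laplacian (trig_poly N c) x = \<dots>" .
qed

lemma integral_norm_grad_trig_poly:
  assumes "hermitian c"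
  shows "(LINT x:cell|lebesgue. (norm (grad (trig_poly N c) x))\<^sup>2)
    = (\<Sum>k\<in>modes N. laplace_symbol k * (cmod (c k))\<^sup>2)"
proof -
  let ?c = "\<lambda>i k. \<i> * of_real (2 * pi * of_int (k $ i)) * c k"
  have herm: "hermitian (?c i)" for i
    using assms by (simp add: hermitian_def)
  have "(norm (grad (trig_poly N c) x))\<^sup>2 = (\<Sum>i\<in>UNIV. (trig_poly N (?c i) x)\<^sup>2)" for x
    by (simp add: grad_def norm_vec_def L2_set_def sum_nonneg partial_trig_poly)
  then have "(LINT x:cell|lebesgue. (norm (grad (trig_poly N c) x))\<^sup>2)
      = (\<Sum>i\<in>UNIV. LINT x:cell|lebesgue. (trig_poly N (?c i) x)\<^sup>2)"
    by (simp only:) (intro set_integral_sum integrable_cell continuous_intros)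
  also have "\<dots> = (\<Sum>i\<in>UNIV. \<Sum>k\<in>modes N. (2 * pi * of_int (k $ i))\<^sup>2 * (cmod (c k))\<^sup>2)"
    by (simp only: parseval[OF herm]) (simp add: norm_mult power_mult_distrib abs_mult)
  also have "\<dots> = (\<Sum>k\<in>modes N. laplace_symbol k * (cmod (c k))\<^sup>2)"
    by (subst sum.swap) (simp add: laplace_symbol_def sum_distrib_right)
  finally show ?thesis .
qed

lemma continuous_on_norm_grad_trig_poly: "continuous_on A (\<lambda>x. norm (grad (trig_poly N c) x))"
  unfolding grad_def partial_trig_poly by (intro continuous_intros continuous_on_vec_lambda)

lemma energy_trig_poly:
  assumes "hermitian c"
  shows "energy \<nu> (trig_poly N c) = \<nu> / 2 * (\<Sum>k\<in>modes N. laplace_symbol k * (cmod (c k))\<^sup>2)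
    + 1/4 * (LINT x:cell|lebesgue. ((trig_poly N c x)\<^sup>2 - 1)\<^sup>2)"
proof -
  have "energy \<nu> (trig_poly N c)
      = (LINT x:cell|lebesgue. 1/2 * \<nu> * (norm (grad (trig_poly N c) x))\<^sup>2)
        + (LINT x:cell|lebesgue. 1/4 * ((trig_poly N c x)\<^sup>2 - 1)\<^sup>2)"
    unfolding energy_def
    by (intro set_integral_add integrable_cell continuous_intros continuous_on_norm_grad_trig_poly)
  then show ?thesis
    by (simp add: integral_norm_grad_trig_poly[OF assms])
qed

section \<open>The critical Sobolev embedding into \<open>L\<^sup>4\<close>\<close>

text \<open>
  The maximum norm as a natural number, so that truncations are indexed by \<open>nat\<close> and
  \<open>modes m\<close> is a ball.
\<close>

definition height :: "int ^ 'd \<Rightarrow> nat" where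
  "height k = nat (freq_norm_inf k)"

lemma height_le_iff: "height k \<le> m \<longleftrightarrow> k \<in> modes m"
  by (auto simp: height_def modes_def)

lemma modes_mono: "m \<le> n \<Longrightarrow> modes m \<subseteq> modes n"
  by (auto simp: height_le_iff[symmetric])

lemma modes_0: "modes 0 = {0}"
  by (auto simp: mem_modes vec_eq_iff)

lemma height_eq_0_iff: "height k = 0 \<longleftrightarrow> k = 0"
  using height_le_iff[of k 0] by (simp add: modes_0)

lemma height_sq_le_laplace_symbol: "(real (height k))\<^sup>2 \<le> laplace_symbol k"
proof -
  have "freq_norm_inf k \<in> range (\<lambda>i. \<bar>k $ i\<bar>)"
    unfolding freq_norm_inf_def by (rule Max_in) auto
  then obtain i where "freq_norm_inf k = \<bar>k $ i\<bar>" by blast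
  then have "real (height k) = \<bar>of_int (k $ i)\<bar>" by (simp add: height_def)
  then have "(real (height k))\<^sup>2 = 1 * (of_int (k $ i))\<^sup>2" by simp
  also have "\<dots> \<le> (2 * pi)\<^sup>2 * (of_int (k $ i))\<^sup>2"
    by (intro mult_right_mono one_le_power) (use pi_ge_two in auto)
  also have "\<dots> = (2 * pi * of_int (k $ i))\<^sup>2"
    by (simp add: power_mult_distrib)
  also have "\<dots> \<le> laplace_symbol k"
    unfolding laplace_symbol_def by (rule member_le_sum) auto
  finally show ?thesis .
qed

lemma laplace_symbol_pos: "k \<noteq> 0 \<Longrightarrow> 0 < laplace_symbol k"
  using height_sq_le_laplace_symbol[of k] height_eq_0_iff[of k]
  by (smt (verit) of_nat_0_eq_iff zero_less_power2)

lemma power_diff_le: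
  fixes x y :: real
  assumes "0 \<le> y" "y \<le> x"
  shows "x ^ n - y ^ n \<le> real n * (x - y) * x ^ (n - 1)"
proof (cases n)
  case (Suc m)
  have "x ^ Suc m - y ^ Suc m = (x - y) * (\<Sum>p<Suc m. x ^ p * y ^ (m - p))"
    by (rule diff_power_eq_sum)
  also have "\<dots> \<le> (x - y) * (\<Sum>p<Suc m. x ^ m)"
  proof (intro mult_left_mono sum_mono)
    fix p assume "p \<in> {..<Suc m}"
    then have "x ^ p * y ^ (m - p) \<le> x ^ p * x ^ (m - p)"
      using assms by (intro mult_left_mono power_mono) auto
    also have "\<dots> = x ^ m" using \<open>p \<in> _\<close> by (simp flip: power_add)
    finally show "x ^ p * y ^ (m - p) \<le> x ^ m" .
  qed (use assms in auto)
  finally show ?thesis using Suc by (simp add: algebra_simps)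
qed auto

text \<open>
  A shell is the difference of two cubes, hence has the size of the boundary of a cube.
\<close>

lemma card_shell_le:
  "real (card {k :: int ^ 'd. height k = Suc m})
    \<le> 2 * real CARD('d) * 3 ^ (CARD('d) - 1) * real (Suc m) ^ (CARD('d) - 1)"
proof -
  let ?d = "CARD('d)"
  have "{k :: int ^ 'd. height k = Suc m} = modes (Suc m) - modes m"
    by (auto simp: height_le_iff[symmetric])
  then have "real (card {k :: int ^ 'd. height k = Suc m})
      = real (card (modes (Suc m) :: (int ^ 'd) set)) - real (card (modes m :: (int ^ 'd) set))"
    by (simp add: card_Diff_subset modes_mono of_nat_diff card_mono)
  also have "\<dots> = (2 * real m + 3) ^ ?d - (2 * real m + 1) ^ ?d"
    by (simp add: card_modes add.commute)
  also have "\<dots> \<le> real ?d * ((2 * real m + 3) - (2 * real m + 1)) * (2 * real m + 3) ^ (?d - 1)"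
    by (rule power_diff_le) auto
  also have "\<dots> \<le> real ?d * 2 * (3 * real (Suc m)) ^ (?d - 1)"
    by (intro mult_mono power_mono) auto
  finally show ?thesis by (simp only: power_mult_distrib mult_ac)
qed

text \<open>
  The Fourier weight of the squared norm of the Sobolev space with \<open>d/4\<close> derivatives, the space that
  scales like \<open>L\<^sup>4\<close>. Its value at \<open>0\<close> is \<open>0\<close>, so the constant mode does not contribute.
\<close>

definition critical_weight :: "'d itself \<Rightarrow> nat \<Rightarrow> real" where
  "critical_weight _ m = real m powr (real CARD('d) / 2)"

text \<open>
  A discrete version of \<open>s n\<^bsup>s-1\<^esup> = (n\<^bsup>s\<^esup>)'\<close>, which turns sums over shells into telescoping sums. With
  \<open>x = m / (m + 1)\<close> it reduces to \<open>x\<^bsup>s\<^esup> \<le> sqrt x \<le> (1 + x) / 2\<close>.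
\<close>

lemma powr_increment_ge:
  fixes s :: real
  assumes "1/2 \<le> s"
  shows "real (Suc m) powr (s - 1) \<le> 2 * (real (Suc m) powr s - real m powr s)"
proof -
  define n where "n = real (Suc m)"
  define x where "x = real m / n"
  have n: "n > 0" and x: "0 \<le> x" "x \<le> 1" by (auto simp: n_def x_def)
  have x_eq: "x = 1 - 1 / n" by (simp add: x_def n_def field_simps)
  have "x powr s \<le> x powr (1/2)"
    using x assms by (intro powr_mono') auto
  also have "\<dots> = sqrt (x * 1)" using x by (simp add: powr_half_sqrt)
  also have "\<dots> \<le> (x + 1) / 2" using x by (intro arith_geo_mean_sqrt) auto
  finally have "x powr s \<le> 1 - 1 / (2 * n)" by (simp add: x_eq field_simps)
  then have "n powr s * x powr s \<le> n powr s * (1 - 1 / (2 * n))"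
    by (intro mult_left_mono) auto
  moreover have "n powr s * x powr s = real m powr s"
    using n x by (simp add: x_def flip: powr_mult)
  ultimately have "n powr s / n \<le> 2 * (n powr s - real m powr s)"
    using n by (simp add: field_simps)
  then show ?thesis using n by (simp add: powr_diff n_def)
qed

text \<open>
  A shell of height \<open>m\<close> contains of the order of \<open>m\<^bsup>d-1\<^esup>\<close> frequencies, so the sum behaves like
  \<open>\<Sum> j\<^bsup>d/2-1\<^esup>\<close> over \<open>j \<le> m\<close>, that is, like \<open>m\<^bsup>d/2\<^esup>\<close>.
\<close>

lemma sum_inverse_critical_weight_le:
  "(\<Sum>k\<in>modes m - {0 :: int ^ 'd}. inverse (critical_weight TYPE('d) (height k)))
    \<le> 4 * real CARD('d) * 3 ^ (CARD('d) - 1) * critical_weight TYPE('d) m"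
proof (induction m)
  case 0
  then show ?case by (simp add: modes_0 critical_weight_def)
next
  case (Suc m)
  let ?d = "CARD('d)" and ?w = "critical_weight TYPE('d)"
  let ?B = "2 * real ?d * 3 ^ (?d - 1)"
  let ?n = "real (Suc m)"
  have d: "?d \<ge> 1" by (simp add: Suc_leI)
  have "finite {k :: int ^ 'd. height k = Suc m}"
    by (rule finite_subset[OF _ finite_modes[of "Suc m"]]) (auto simp flip: height_le_iff)
  moreover have "modes (Suc m) - {0 :: int ^ 'd} = (modes m - {0}) \<union> {k. height k = Suc m}"
    by (auto simp: height_eq_0_iff simp flip: height_le_iff)
      (metis height_eq_0_iff nat.distinct(1))
  moreover have "(modes m - {0 :: int ^ 'd}) \<inter> {k. height k = Suc m} = {}"
    by (auto simp flip: height_le_iff)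
  ultimately have split: "(\<Sum>k\<in>modes (Suc m) - {0 :: int ^ 'd}. inverse (?w (height k)))
      = (\<Sum>k\<in>modes m - {0 :: int ^ 'd}. inverse (?w (height k)))
        + real (card {k :: int ^ 'd. height k = Suc m}) * inverse (?w (Suc m))"
    by (simp add: sum.union_disjoint)
  have "real (card {k :: int ^ 'd. height k = Suc m}) * inverse (?w (Suc m))
      \<le> ?B * ?n ^ (?d - 1) * inverse (?w (Suc m))"
    by (intro mult_right_mono card_shell_le) (simp add: critical_weight_def)
  also have "\<dots> = ?B * (?n powr (real ?d - 1) * ?n powr (- (real ?d / 2)))"
  proof -
    have "?n ^ (?d - 1) = ?n powr (real ?d - 1)"
      using d powr_realpow[of ?n "?d - 1"] by (simp add: of_nat_diff)
    moreover have "inverse (?w (Suc m)) = ?n powr (- (real ?d / 2))"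
      by (simp add: critical_weight_def powr_minus)
    ultimately show ?thesis by (simp only: mult.assoc)
  qed
  also have "\<dots> = ?B * ?n powr (real ?d / 2 - 1)"
    by (simp flip: powr_add)
  also have "\<dots> \<le> ?B * (2 * (?w (Suc m) - ?w m))"
    unfolding critical_weight_def using d by (intro mult_left_mono powr_increment_ge) auto
  also have "\<dots> = 4 * real ?d * 3 ^ (?d - 1) * ?w (Suc m) - 4 * real ?d * 3 ^ (?d - 1) * ?w m"
    by (simp add: right_diff_distrib)
  finally show ?case using Suc.IH split by linarith
qed

text \<open>
  A Bernstein inequality: the Cauchy-Schwarz inequality bounds the sum of the moduli of the
  coefficients by the Sobolev norm, at the price of the lattice sum above.
\<close>

lemma low_frequency_bound:
  fixes c :: "int ^ 'd \<Rightarrow> complex"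
  assumes "c 0 = 0" "m \<le> N"
  shows "(trig_poly m c x)\<^sup>2 \<le> 4 * real CARD('d) * 3 ^ (CARD('d) - 1) * critical_weight TYPE('d) m
    * (\<Sum>k\<in>modes N. critical_weight TYPE('d) (height k) * (cmod (c k))\<^sup>2)"
proof -
  let ?w = "\<lambda>k :: int ^ 'd. critical_weight TYPE('d) (height k)"
  have w: "?w k > 0" if "k \<noteq> 0" for k
    using that height_eq_0_iff[of k] by (simp add: critical_weight_def)
  have w0: "?w k \<ge> 0" for k by (simp add: critical_weight_def)
  have "\<bar>trig_poly m c x\<bar> \<le> cmod (\<Sum>k\<in>modes m. c k * cis (2 * pi * freq_dot k x))"
    unfolding trig_poly_def by (rule abs_Re_le_cmod)
  also have "\<dots> \<le> (\<Sum>k\<in>modes m. cmod (c k))"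
    by (rule order_trans[OF norm_sum]) (simp add: norm_mult)
  also have "\<dots> = (\<Sum>k\<in>modes m - {0}. cmod (c k))"
    using assms by (intro sum.mono_neutral_right) auto
  also have "\<dots> = (\<Sum>k\<in>modes m - {0}. sqrt (inverse (?w k)) * (sqrt (?w k) * cmod (c k)))"
  proof (intro sum.cong refl)
    fix k :: "int ^ 'd" assume "k \<in> modes m - {0}"
    then have "sqrt (inverse (?w k)) * sqrt (?w k) = 1"
      using w[of k] by (simp flip: real_sqrt_mult)
    then show "cmod (c k) = sqrt (inverse (?w k)) * (sqrt (?w k) * cmod (c k))"
      by (simp flip: mult.assoc)
  qed
  finally have "(trig_poly m c x)\<^sup>2
      \<le> (\<Sum>k\<in>modes m - {0}. sqrt (inverse (?w k)) * (sqrt (?w k) * cmod (c k)))\<^sup>2"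
    by (rule abs_le_square_iff[THEN iffD1, OF order_trans[OF _ abs_ge_self]])
  also have "\<dots> \<le> (\<Sum>k\<in>modes m - {0}. (sqrt (inverse (?w k)))\<^sup>2)
      * (\<Sum>k\<in>modes m - {0}. (sqrt (?w k) * cmod (c k))\<^sup>2)"
    by (rule Cauchy_Schwarz_ineq_sum)
  also have "\<dots> = (\<Sum>k\<in>modes m - {0}. inverse (?w k)) * (\<Sum>k\<in>modes m - {0}. ?w k * (cmod (c k))\<^sup>2)"
    using w0 by (simp add: power_mult_distrib)
  also have "\<dots> \<le> (4 * real CARD('d) * 3 ^ (CARD('d) - 1) * critical_weight TYPE('d) m)
      * (\<Sum>k\<in>modes N. ?w k * (cmod (c k))\<^sup>2)"
    using modes_mono[OF assms(2)] w0
    by (intro mult_mono sum_inverse_critical_weight_le sum_mono2 sum_nonneg)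
      (auto simp: critical_weight_def)
  finally show ?thesis .
qed

text \<open>
  A discrete layer-cake formula. Think of \<open>l m\<close> as the value at one point of the truncation to
  frequencies at most \<open>m\<close>, and of \<open>A m\<close> as a bound for its square. As long as \<open>4 * A m\<close> is at most
  \<open>(l N)\<^sup>2\<close>, the low part accounts for at most half of \<open>l N\<close>, so the high part \<open>l N - l m\<close> carries the
  other half. Up to the largest such \<open>m\<close> the increments of \<open>A\<close> add up to more than \<open>(l N)\<^sup>2 / 4\<close>.
\<close>

lemma truncation_levels_control_fourth_power:
  fixes A l :: "nat \<Rightarrow> real"
  assumes "mono A" "A 0 = 0" and low: "\<And>m. m \<le> N \<Longrightarrow> (l m)\<^sup>2 \<le> A m"
  shows "(l N) ^ 4 \<le> 16 * (\<Sum>m<N. (A (Suc m) - A m) * (l N - l m)\<^sup>2)"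
proof (cases "l N = 0")
  case True
  then show ?thesis
    using monoD[OF \<open>mono A\<close>] by (auto intro!: sum_nonneg mult_nonneg_nonneg)
next
  case False
  define L where "L = {m. m \<le> N \<and> 4 * A m \<le> (l N)\<^sup>2}"
  define M where "M = Max L"
  have "finite L" "0 \<in> L" using \<open>A 0 = 0\<close> by (auto simp: L_def)
  then have "M \<in> L" unfolding M_def by (intro Max_in) auto
  have "(l N)\<^sup>2 > 0" using False by simp
  \<comment> \<open>At full resolution there is no high part, so the maximal level lies strictly below \<open>N\<close>.\<close>
  then have "\<not> 4 * A N \<le> (l N)\<^sup>2" using low[of N] by linarith
  then have "N \<notin> L" by (simp add: L_def)
  with \<open>M \<in> L\<close> have "M < N" by (auto simp: L_def order_le_less)
  have "Suc M \<notin> L"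
    using Max_ge[OF \<open>finite L\<close>, of "Suc M"] by (auto simp: M_def)
  with \<open>M < N\<close> have top: "(l N)\<^sup>2 < 4 * A (Suc M)" by (auto simp: L_def)
  have high: "(l N)\<^sup>2 / 4 \<le> (l N - l m)\<^sup>2" if "m \<le> M" for m
  proof -
    have "4 * (l m)\<^sup>2 \<le> 4 * A m" using that \<open>M < N\<close> low by simp
    also have "\<dots> \<le> 4 * A M" using monoD[OF \<open>mono A\<close> that] by simp
    also have "\<dots> \<le> (l N)\<^sup>2" using \<open>M \<in> L\<close> by (simp add: L_def)
    finally have "(2 * l m)\<^sup>2 \<le> (l N)\<^sup>2" by (simp add: power_mult_distrib)
    then have "\<bar>2 * l m\<bar> \<le> \<bar>l N\<bar>" by (simp only: abs_le_square_iff)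
    then have "\<bar>l N / 2\<bar> \<le> \<bar>l N - l m\<bar>" by linarith
    then have "(l N / 2)\<^sup>2 \<le> (l N - l m)\<^sup>2" by (simp only: abs_le_square_iff)
    then show ?thesis by (simp add: power_divide)
  qed
  have "(l N) ^ 4 = (l N)\<^sup>2 * (l N)\<^sup>2" by (simp flip: power_add)
  also have "\<dots> \<le> (4 * A (Suc M)) * (l N)\<^sup>2"
    using top by (intro mult_right_mono) auto
  also have "A (Suc M) = (\<Sum>m<Suc M. A (Suc m) - A m)"
    using \<open>A 0 = 0\<close> by (subst sum_lessThan_telescope) simp
  also have "4 * (\<Sum>m<Suc M. A (Suc m) - A m) * (l N)\<^sup>2
      = 16 * (\<Sum>m<Suc M. (A (Suc m) - A m) * ((l N)\<^sup>2 / 4))"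
    by (simp only: sum_distrib_right[symmetric])
  also have "\<dots> \<le> 16 * (\<Sum>m<Suc M. (A (Suc m) - A m) * (l N - l m)\<^sup>2)"
    using high monoD[OF \<open>mono A\<close>] by (intro mult_left_mono sum_mono) auto
  also have "\<dots> \<le> 16 * (\<Sum>m<N. (A (Suc m) - A m) * (l N - l m)\<^sup>2)"
    using \<open>M < N\<close> monoD[OF \<open>mono A\<close>] by (intro mult_left_mono sum_mono2) auto
  finally show ?thesis .
qed

lemma parseval_high_frequencies:
  assumes "hermitian c" "m \<le> N"
  shows "(LINT x:cell|lebesgue. (trig_poly N c x - trig_poly m c x)\<^sup>2)
    = (\<Sum>k\<in>modes N. if height k \<le> m then 0 else (cmod (c k))\<^sup>2)"
proof -
  let ?c = "\<lambda>k. if height k \<le> m then 0 else c k"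
  have herm: "hermitian ?c"
    using assms by (simp add: hermitian_def height_le_iff)
  have split: "trig_poly N c x - trig_poly m c x = trig_poly N ?c x" for x
  proof -
    have "(\<Sum>k\<in>modes m. c k * cis (2 * pi * freq_dot k x))
        = (\<Sum>k\<in>modes N. if k \<in> modes m then c k * cis (2 * pi * freq_dot k x) else 0)"
      using modes_mono[OF assms(2)] by (intro sum.mono_neutral_cong_left) auto
    then show ?thesis
      unfolding trig_poly_def minus_complex.sel(1)[symmetric]
      by (intro arg_cong[where f = Re]) (auto simp: height_le_iff simp flip: sum_subtractf intro!: sum.cong)
  qed
  show ?thesis
    unfolding split parseval[OF herm] by (intro sum.cong) auto
qed

text \<open>
  The truncation argument of Chemin and Xu. Integrating the pointwise layer-cake bound, with
  \<open>A m\<close> the bound of \<open>low_frequency_bound\<close>, turns each high part into its coefficient sum by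
  Parseval; interchanging the sums, the increments of \<open>A\<close> telescope at each frequency to the
  critical weight. One factor \<open>S\<close> comes from \<open>A\<close> and the other one from this coefficient sum.
\<close>

theorem critical_sobolev_L4:
  fixes c :: "int ^ 'd \<Rightarrow> complex"
  assumes "hermitian c" "c 0 = 0"
  shows "sqrt (LINT x:cell|lebesgue. (trig_poly N c x) ^ 4)
    \<le> 4 * sqrt (4 * real CARD('d) * 3 ^ (CARD('d) - 1))
      * (\<Sum>k\<in>modes N. critical_weight TYPE('d) (height k) * (cmod (c k))\<^sup>2)"
proof -
  let ?w = "critical_weight TYPE('d)"
  define B where "B = 4 * real CARD('d) * 3 ^ (CARD('d) - 1)"
  define S where "S = (\<Sum>k\<in>modes N. ?w (height k) * (cmod (c k))\<^sup>2)"
  define A where "A m = B * ?w m * S" for m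
  have "B \<ge> 0" by (simp add: B_def)
  have "S \<ge> 0" unfolding S_def by (intro sum_nonneg) (simp add: critical_weight_def)
  have "mono A"
    unfolding A_def critical_weight_def using \<open>B \<ge> 0\<close> \<open>S \<ge> 0\<close>
    by (intro monoI mult_right_mono mult_left_mono powr_mono2) auto
  have A0: "A 0 = 0" by (simp add: A_def critical_weight_def)
  have pw: "(trig_poly N c x) ^ 4
      \<le> 16 * (\<Sum>m<N. (A (Suc m) - A m) * (trig_poly N c x - trig_poly m c x)\<^sup>2)" for x
    using low_frequency_bound[of c _ N x] assms(2)
    by (intro truncation_levels_control_fourth_power[OF \<open>mono A\<close> A0]) (simp add: A_def B_def S_def)
  have "(LINT x:cell|lebesgue. (trig_poly N c x) ^ 4)
      \<le> (LINT x:cell|lebesgue. 16 * (\<Sum>m<N. (A (Suc m) - A m) * (trig_poly N c x - trig_poly m c x)\<^sup>2))"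
    by (intro set_integral_mono integrable_cell continuous_intros pw)
  also have "\<dots> = 16 * (\<Sum>m<N. (A (Suc m) - A m)
      * (LINT x:cell|lebesgue. (trig_poly N c x - trig_poly m c x)\<^sup>2))"
    by (subst set_integral_mult_right, subst set_integral_sum)
      (auto intro!: integrable_cell continuous_intros)
  also have "\<dots> = 16 * (\<Sum>m<N. \<Sum>k\<in>modes N.
      if height k \<le> m then 0 else (A (Suc m) - A m) * (cmod (c k))\<^sup>2)"
    by (simp add: parseval_high_frequencies[OF assms(1)] sum_distrib_left if_distrib cong: if_cong)
  also have "\<dots> = 16 * (\<Sum>k\<in>modes N. \<Sum>m<N.
      if height k \<le> m then 0 else (A (Suc m) - A m) * (cmod (c k))\<^sup>2)"
    by (subst sum.swap) simp
  also have "\<dots> = 16 * (\<Sum>k\<in>modes N. A (height k) * (cmod (c k))\<^sup>2)"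
  proof (intro arg_cong[where f = "\<lambda>t. 16 * t"] sum.cong refl)
    fix k :: "int ^ 'd" assume "k \<in> modes N"
    then have "height k \<le> N" by (simp add: height_le_iff)
    then have "(\<Sum>m<N. if height k \<le> m then 0 else (A (Suc m) - A m) * (cmod (c k))\<^sup>2)
        = (\<Sum>m<height k. (A (Suc m) - A m) * (cmod (c k))\<^sup>2)"
      by (intro sum.mono_neutral_cong_right) auto
    also have "\<dots> = A (height k) * (cmod (c k))\<^sup>2"
      by (simp only: sum_distrib_right[symmetric] sum_lessThan_telescope A0) simp
    finally show "(\<Sum>m<N. if height k \<le> m then 0 else (A (Suc m) - A m) * (cmod (c k))\<^sup>2)
        = A (height k) * (cmod (c k))\<^sup>2" .
  qed
  also have "(\<Sum>k\<in>modes N. A (height k) * (cmod (c k))\<^sup>2) = B * S * S"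
    unfolding A_def S_def[symmetric] sum_distrib_left[of _ _ "modes N"]
    by (subst (2) S_def) (simp add: sum_distrib_left mult_ac)
  also have "16 * (B * S * S) = (4 * sqrt B * S)\<^sup>2"
    using \<open>B \<ge> 0\<close> by (simp add: power_mult_distrib power2_eq_square[of S])
  finally have "sqrt (LINT x:cell|lebesgue. (trig_poly N c x) ^ 4) \<le> 4 * sqrt B * S"
    using \<open>B \<ge> 0\<close> \<open>S \<ge> 0\<close> by (intro real_le_lsqrt) auto
  then show ?thesis by (simp add: B_def S_def)
qed

section \<open>The dissipation controls the \<open>L\<^sup>4\<close> norm of the increment\<close>

text \<open>
  If \<open>\<epsilon> \<nu> y\<close> alone does not dominate, then \<open>y\<close> is below the threshold \<open>(\<epsilon> \<nu>)\<^bsup>-4/(4-d)\<^esup>\<close>; there the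
  term \<open>1 / (y \<tau>)\<close> is large enough by the choice of \<open>\<tau>\<close>. Balancing the two terms at the threshold is what
  fixes the exponent \<open>(4 + d) / (4 - d)\<close>.
\<close>

lemma interpolation_powr:
  fixes d :: real
  assumes "0 < d" "d < 4" and pos: "0 < \<epsilon>" "0 < \<nu>" "0 < \<tau>" "0 < y"
    and \<tau>: "\<tau> \<le> \<epsilon> * (\<epsilon> * \<nu>) powr ((4 + d) / (4 - d))"
  shows "y powr (d / 4) \<le> \<epsilon> * (1 / (y * \<tau>) + \<nu> * y)"
proof (cases "y powr (d / 4) \<le> \<epsilon> * \<nu> * y")
  case True
  then show ?thesis using pos by (simp add: distrib_left add_increasing mult.assoc)
next
  case False
  then have "\<epsilon> * \<nu> \<le> y powr (d / 4) / y"
    using pos by (simp add: field_simps)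
  also have "\<dots> = y powr (d / 4 - 1)"
    using pos by (simp add: powr_diff)
  also have "d / 4 - 1 = - ((4 - d) / 4)" by (simp add: field_simps)
  finally have "(\<epsilon> * \<nu>) powr ((4 + d) / (4 - d)) \<le> (y powr (- ((4 - d) / 4))) powr ((4 + d) / (4 - d))"
    using pos assms(1,2) by (intro powr_mono2) auto
  also have "\<dots> = y powr (- (1 + d / 4))"
  proof -
    have "- ((4 - d) / 4) * ((4 + d) / (4 - d)) = - (1 + d / 4)"
    proof -
      have "q / 4 * (r / q) = r / 4" if "q \<noteq> 0" for q r :: real
        using that by simp
      from this[of "4 - d" "4 + d"] have "(4 - d) / 4 * ((4 + d) / (4 - d)) = (4 + d) / 4"
        using assms(2) by linarith
      then show ?thesis by (simp add: add_divide_distrib)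
    qed
    then show ?thesis by (simp only: powr_powr)
  qed
  also have "\<dots> = 1 / (y * y powr (d / 4))"
    using pos by (simp only: powr_minus powr_add powr_one inverse_eq_divide less_imp_le)
  finally have "\<tau> \<le> \<epsilon> * (1 / (y * y powr (d / 4)))"
    using \<tau> pos by (meson mult_left_mono less_imp_le order_trans)
  then have "y powr (d / 4) \<le> \<epsilon> * (1 / (y * \<tau>))"
  proof -
    assume "\<tau> \<le> \<epsilon> * (1 / (y * y powr (d / 4)))"
    moreover have "y powr (d / 4) > 0" using pos by simp
    ultimately show ?thesis using pos
      by (simp add: pos_le_divide_eq mult_ac)
  qed
  then show ?thesis using pos by (simp add: distrib_left add_increasing2)
qed

lemma height_weight_le_laplace_symbol:
  "critical_weight TYPE('d) (height k) \<le> laplace_symbol k powr (real CARD('d) / 4)"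
  for k :: "int ^ 'd"
proof -
  have "critical_weight TYPE('d) (height k) = ((real (height k))\<^sup>2) powr (real CARD('d) / 4)"
    unfolding critical_weight_def
    by (cases "height k = 0") (simp_all add: powr_powr flip: powr_numeral)
  also have "\<dots> \<le> laplace_symbol k powr (real CARD('d) / 4)"
    using height_sq_le_laplace_symbol[of k] by (intro powr_mono2) auto
  finally show ?thesis .
qed

text \<open>
  The quantity gained in one step: \<open>1 / \<tau>\<close> times the squared norm of \<open>c\<close> in the dual of \<open>H\<^sup>1\<close>, plus
  \<open>\<nu> / 2\<close> times its squared gradient norm. At \<open>k = 0\<close> the symbol vanishes and so does the summand,
  by the convention \<open>1 / 0 = 0\<close>.
\<close>

definition dissipation :: "real \<Rightarrow> real \<Rightarrow> nat \<Rightarrow> (int ^ 'd \<Rightarrow> complex) \<Rightarrow> real" where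
  "dissipation \<nu> \<tau> N c = (\<Sum>k\<in>modes N.
     (1 / (laplace_symbol k * \<tau>) + \<nu> / 2 * laplace_symbol k) * (cmod (c k))\<^sup>2)"

definition sobolev_const :: "'d itself \<Rightarrow> real" where
  "sobolev_const _ = 4 * sqrt (4 * real CARD('d) * 3 ^ (CARD('d) - 1))"

lemma sobolev_const_pos: "0 < sobolev_const TYPE('d::finite)"
  by (simp add: sobolev_const_def)

lemma L4_le_dissipation:
  fixes c :: "int ^ 'd \<Rightarrow> complex"
  assumes d: "CARD('d) < 4" and c: "hermitian c" "c 0 = 0"
    and pos: "0 < \<epsilon>" "0 < \<nu>" "0 < \<tau>"
    and \<tau>: "\<tau> \<le> \<epsilon> * (\<epsilon> * \<nu>) powr ((4 + real CARD('d)) / (4 - real CARD('d)))"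
  shows "sqrt (LINT x:cell|lebesgue. (trig_poly N c x) ^ 4)
    \<le> 2 * sobolev_const TYPE('d) * \<epsilon> * dissipation \<nu> \<tau> N c"
proof -
  have weight: "critical_weight TYPE('d) (height k) * (cmod (c k))\<^sup>2
      \<le> 2 * \<epsilon> * ((1 / (laplace_symbol k * \<tau>) + \<nu> / 2 * laplace_symbol k) * (cmod (c k))\<^sup>2)" for k
  proof (cases "k = 0")
    case True
    then show ?thesis using c by simp
  next
    case False
    then have lam: "0 < laplace_symbol k" by (rule laplace_symbol_pos)
    have "critical_weight TYPE('d) (height k) \<le> \<epsilon> * (1 / (laplace_symbol k * \<tau>) + \<nu> * laplace_symbol k)"
      using height_weight_le_laplace_symbol[of k]
        interpolation_powr[of "real CARD('d)" \<epsilon> \<nu> \<tau> "laplace_symbol k"] d lam pos \<tau> by simp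
    also have "\<dots> \<le> \<epsilon> * (2 * (1 / (laplace_symbol k * \<tau>) + \<nu> / 2 * laplace_symbol k))"
    proof -
      \<comment> \<open>The factor \<open>2\<close> pays for the weight \<open>\<nu> / 2\<close> in the dissipation.\<close>
      have "X + \<nu> * laplace_symbol k \<le> 2 * (X + \<nu> / 2 * laplace_symbol k)" if "0 \<le> X" for X
        using that by simp
      from mult_left_mono[OF this[of "1 / (laplace_symbol k * \<tau>)"], of \<epsilon>] show ?thesis
        using pos lam by simp
    qed
    finally show ?thesis
      by (simp only: mult.assoc[symmetric] mult.commute[of 2 \<epsilon>]) (intro mult_right_mono, auto)
  qed
  have "sqrt (LINT x:cell|lebesgue. (trig_poly N c x) ^ 4) \<le> sobolev_const TYPE('d)
      * (\<Sum>k\<in>modes N. critical_weight TYPE('d) (height k) * (cmod (c k))\<^sup>2)"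
    unfolding sobolev_const_def by (rule critical_sobolev_L4) fact+
  also have "\<dots> \<le> sobolev_const TYPE('d) * (2 * \<epsilon> * dissipation \<nu> \<tau> N c)"
    unfolding dissipation_def sum_distrib_left[of "2 * \<epsilon>"]
    by (intro mult_left_mono sum_mono weight) (simp add: sobolev_const_pos less_imp_le)
  finally show ?thesis by (simp only: mult_ac)
qed

section \<open>One step of the scheme\<close>

lemma cmod_mult_cnj_diff:
  "Re (b * cnj (b - a)) = ((cmod b)\<^sup>2 - (cmod a)\<^sup>2 + (cmod (b - a))\<^sup>2) / 2"
  unfolding cmod_power2 by (simp add: power2_eq_square field_simps)

text \<open>
  The scheme tested with the inverse Laplacian of the increment. The implicit term is split by
  \<open>cmod_mult_cnj_diff\<close>, which produces both the change of the gradient energy and the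
  dissipative part \<open>\<nu> \<lambda> / 2\<close>.
\<close>

lemma scheme_pairing:
  fixes a b f :: "int ^ 'd \<Rightarrow> complex"
  assumes "0 < \<tau>"
    and eq: "\<And>k. k \<in> modes N \<Longrightarrow> (b k - a k) / of_real \<tau>
      = - of_real (\<nu> * (laplace_symbol k)\<^sup>2) * b k - of_real (laplace_symbol k) * f k"
  shows "(\<Sum>k\<in>modes N. Re (f k * cnj (b k - a k)))
      + \<nu> / 2 * ((\<Sum>k\<in>modes N. laplace_symbol k * (cmod (b k))\<^sup>2)
        - (\<Sum>k\<in>modes N. laplace_symbol k * (cmod (a k))\<^sup>2))
    = - dissipation \<nu> \<tau> N (\<lambda>k. b k - a k)"
proof -
  have "Re (f k * cnj (b k - a k)) + \<nu> / 2 * (laplace_symbol k * (cmod (b k))\<^sup>2 - laplace_symbol k * (cmod (a k))\<^sup>2)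
      = - ((1 / (laplace_symbol k * \<tau>) + \<nu> / 2 * laplace_symbol k) * (cmod (b k - a k))\<^sup>2)"
    if "k \<in> modes N" for k
  proof (cases "k = 0")
    case True
    \<comment> \<open>Conservation of mass, which also makes the inverse Laplacian of the increment meaningful.\<close>
    with eq[OF that] assms(1) have "b k - a k = 0" by simp
    with True show ?thesis by simp
  next
    case False
    define l where "l = laplace_symbol k"
    define e where "e = b k - a k"
    have "l > 0" using False by (simp add: l_def laplace_symbol_pos)
    have "e / of_real \<tau> = - of_real (\<nu> * l\<^sup>2) * b k - of_real l * f k"
      using eq[OF that] by (simp add: e_def l_def)
    then have "of_real l * f k = - (e / of_real \<tau>) - of_real (\<nu> * l\<^sup>2) * b k"
      by simp
    then have "f k = (- (e / of_real \<tau>) - of_real (\<nu> * l\<^sup>2) * b k) / of_real l"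
      using \<open>l > 0\<close> by (simp add: eq_divide_eq mult.commute)
    also have "\<dots> = - (of_real (1 / (l * \<tau>)) * e) - of_real (\<nu> * l) * b k"
      using \<open>l > 0\<close> by (simp add: diff_divide_distrib power2_eq_square)
    finally have "f k = - (of_real (1 / (l * \<tau>)) * e) - of_real (\<nu> * l) * b k" .
    moreover have "Re ((- (of_real p * e) - of_real q * z) * cnj e) = - (p * Re (e * cnj e)) - q * Re (z * cnj e)"
      for p q z
      by (simp add: algebra_simps)
    ultimately have "Re (f k * cnj e) = - (1 / (l * \<tau>) * Re (e * cnj e)) - \<nu> * l * Re (b k * cnj e)"
      by (simp only:)
    also have "Re (e * cnj e) = (cmod e)\<^sup>2"
      unfolding cmod_power2 by (simp add: power2_eq_square)
    also have "Re (b k * cnj e) = ((cmod (b k))\<^sup>2 - (cmod (a k))\<^sup>2 + (cmod e)\<^sup>2) / 2"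
      unfolding e_def by (rule cmod_mult_cnj_diff)
    finally have pair: "Re (f k * cnj e) = - (1 / (l * \<tau>) * (cmod e)\<^sup>2)
        - \<nu> * l * (((cmod (b k))\<^sup>2 - (cmod (a k))\<^sup>2 + (cmod e)\<^sup>2) / 2)" .
    show ?thesis
      unfolding l_def[symmetric] e_def[symmetric] pair
      using \<open>l > 0\<close> assms(1) by (simp add: field_simps)
  qed
  then show ?thesis
    unfolding dissipation_def
    by (simp only: sum_distrib_left sum_subtractf[symmetric] sum.distrib[symmetric] sum_negf[symmetric]
        cong: sum.cong)
qed

text \<open>
  Exact Taylor expansion of the double well; the cubic term \<open>s t\<^sup>3\<close> is at most \<open>(s\<^sup>2 t\<^sup>2 + t\<^sup>4) / 2\<close>, and the
  concave part of the potential has the favourable sign.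
\<close>

lemma potential_increment:
  fixes s t :: real
  shows "1/4 * ((s + t)\<^sup>2 - 1)\<^sup>2 \<le> 1/4 * (s\<^sup>2 - 1)\<^sup>2 + nonlin s * t + 2 * (s\<^sup>2 * t\<^sup>2) + 3/4 * t ^ 4"
proof -
  have "1/4 * (s\<^sup>2 - 1)\<^sup>2 + nonlin s * t + 2 * (s\<^sup>2 * t\<^sup>2) + 3/4 * t ^ 4 - 1/4 * ((s + t)\<^sup>2 - 1)\<^sup>2
      = 1/2 * t\<^sup>2 + 1/2 * (t * (s - t))\<^sup>2"
    by (simp add: nonlin_def power2_eq_square power3_eq_cube power4_eq_xxxx algebra_simps)
  also have "\<dots> \<ge> 0" by simp
  finally show ?thesis by simp
qed

text \<open>
  Grouping \<open>nonlin s * t\<close> as \<open>(s\<^sup>2 - 1) (s t)\<close> makes the lower bound grow only quadratically in the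
  increment \<open>t\<close>; a bound with \<open>t\<^sup>4\<close> would not give an a priori estimate for the dissipation.
\<close>

lemma nonlin_mult_ge:
  fixes s t :: real
  shows "- (1/2 * (s\<^sup>2 - 1)\<^sup>2 + 1/2 * (s\<^sup>2 * t\<^sup>2)) \<le> nonlin s * t"
proof -
  have "nonlin s * t + (1/2 * (s\<^sup>2 - 1)\<^sup>2 + 1/2 * (s\<^sup>2 * t\<^sup>2)) = 1/2 * ((s\<^sup>2 - 1) + s * t)\<^sup>2"
    by (simp add: nonlin_def power2_eq_square power3_eq_cube algebra_simps)
  also have "\<dots> \<ge> 0" by simp
  finally show ?thesis by simp
qed

text \<open>
  Here \<open>P\<close> is \<open>\<integral>a\<^sup>2 e\<^sup>2\<close>, \<open>z\<close> the square of the \<open>L\<^sup>4\<close> norm of the increment and \<open>M\<close> the bound for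
  \<open>\<integral>a\<^sup>4\<close>. The value of \<open>\<eta>\<close> makes \<open>P \<le> D / 4\<close>; then the first hypothesis yields \<open>D \<le> 3 E \<le> M\<close>, and this
  a priori bound makes the quadratic term \<open>z\<^sup>2 \<le> D\<^sup>2 / (16 M)\<close> linear in \<open>D\<close>.
\<close>

lemma absorption:
  fixes D P z M E \<eta> :: real
  assumes D: "D \<le> 2 * E + P / 2" and P: "P \<le> sqrt M * z" and z: "0 \<le> z" "z \<le> \<eta> * D"
    and M: "M = 8 * E + 2" and \<eta>: "\<eta> = 1 / (4 * sqrt M)" and E: "0 \<le> E"
  shows "2 * P + 3/4 * z\<^sup>2 \<le> D"
proof -
  have "M > 0" using E M by simp
  then have sM: "sqrt M > 0" "sqrt M * sqrt M = M" by auto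
  have "0 \<le> \<eta> * D" using z by simp
  moreover have "\<eta> > 0" using sM \<eta> by simp
  ultimately have "D \<ge> 0" by (simp add: zero_le_mult_iff)
  have "sqrt M * z \<le> sqrt M * (\<eta> * D)" using z sM by (intro mult_left_mono) auto
  also have "\<dots> = D / 4" using sM \<eta> by simp
  finally have P4: "P \<le> D / 4" using P by simp
  then have D3: "D \<le> 3 * E" using D \<open>D \<ge> 0\<close> by linarith
  have "z\<^sup>2 \<le> (\<eta> * D)\<^sup>2" using z by (intro power_mono) auto
  also have "\<dots> = D * D / (16 * M)" using sM by (simp add: \<eta> power2_eq_square)
  also have "\<dots> \<le> D * M / (16 * M)"
    using D3 M E \<open>D \<ge> 0\<close> \<open>M > 0\<close> by (intro divide_right_mono mult_left_mono) auto
  also have "\<dots> = D / 16" using \<open>M > 0\<close> by simp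
  finally show ?thesis using P4 \<open>D \<ge> 0\<close> by linarith
qed

lemma energy_nonneg: "0 \<le> \<nu> \<Longrightarrow> 0 \<le> energy \<nu> g"
  unfolding energy_def by (rule integral_cell_nonneg) simp

text \<open>
  The double well grows like a fourth power, so the energy controls the \<open>L\<^sup>4\<close> norm independently
  of \<open>\<nu>\<close>.
\<close>

lemma integral_L4_le_energy:
  assumes "hermitian c" "0 \<le> \<nu>"
  shows "(LINT x:cell|lebesgue. (trig_poly N c x) ^ 4) \<le> 8 * energy \<nu> (trig_poly N c) + 2"
proof -
  let ?g = "trig_poly N c"
  have "(LINT x:cell|lebesgue. (?g x) ^ 4) \<le> (LINT x:cell|lebesgue. 2 * ((?g x)\<^sup>2 - 1)\<^sup>2 + 2 * 1)"
  proof (rule integral_cell_mono)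
    fix x
    have "0 \<le> (((?g x)\<^sup>2 - 1) - 1)\<^sup>2" by simp
    then show "(?g x) ^ 4 \<le> 2 * ((?g x)\<^sup>2 - 1)\<^sup>2 + 2 * 1"
      by (simp add: power2_eq_square power4_eq_xxxx algebra_simps)
  qed (intro continuous_intros)+
  also have "\<dots> = 2 * (LINT x:cell|lebesgue. ((?g x)\<^sup>2 - 1)\<^sup>2) + 2"
    by (subst integral_cell_linear) (auto intro!: continuous_intros simp: integral_cell_const)
  also have "\<dots> \<le> 8 * energy \<nu> ?g + 2"
    unfolding energy_trig_poly[OF assms(1)]
    using assms(2) by (simp add: sum_nonneg laplace_symbol_nonneg)
  finally show ?thesis .
qed

text \<open>
  The bound \<open>E\<close> is kept separate from the energy of \<open>a\<close> so that the smallness condition is the same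
  at every time step.
\<close>

theorem energy_step:
  fixes a b :: "int ^ 'd \<Rightarrow> complex"
  assumes a: "hermitian a" and b: "hermitian b" and pos: "0 < \<nu>" "0 < \<tau>"
    and eq: "\<And>k. k \<in> modes N \<Longrightarrow> (b k - a k) / of_real \<tau>
      = - of_real (\<nu> * (laplace_symbol k)\<^sup>2) * b k
        - of_real (laplace_symbol k) * fourier (\<lambda>y. nonlin (trig_poly N a y)) k"
    and E: "energy \<nu> (trig_poly N a) \<le> E"
    and L4: "sqrt (LINT x:cell|lebesgue. (trig_poly N (\<lambda>k. b k - a k) x) ^ 4)
      \<le> 1 / (4 * sqrt (8 * E + 2)) * dissipation \<nu> \<tau> N (\<lambda>k. b k - a k)"
  shows "energy \<nu> (trig_poly N b) \<le> energy \<nu> (trig_poly N a)"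
proof -
  let ?a = "trig_poly N a" and ?e = "trig_poly N (\<lambda>k. b k - a k)"
  note cont = continuous_on_trig_poly[of UNIV N a] continuous_on_trig_poly[of UNIV N "\<lambda>k. b k - a k"]
  define Ga where "Ga = (\<Sum>k\<in>modes N. laplace_symbol k * (cmod (a k))\<^sup>2)"
  define Gb where "Gb = (\<Sum>k\<in>modes N. laplace_symbol k * (cmod (b k))\<^sup>2)"
  define D where "D = dissipation \<nu> \<tau> N (\<lambda>k. b k - a k)"
  define W where "W = (LINT x:cell|lebesgue. ((?a x)\<^sup>2 - 1)\<^sup>2)"
  define V where "V = (LINT x:cell|lebesgue. ((trig_poly N b x)\<^sup>2 - 1)\<^sup>2)"
  define J where "J = (LINT x:cell|lebesgue. nonlin (?a x) * ?e x)"
  define P where "P = (LINT x:cell|lebesgue. (?a x)\<^sup>2 * (?e x)\<^sup>2)"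
  define Z where "Z = (LINT x:cell|lebesgue. (?e x) ^ 4)"
  have cont_nonlin: "continuous_on UNIV (\<lambda>x. nonlin (?a x))"
    unfolding nonlin_def by (intro continuous_intros)
  have Ea: "energy \<nu> ?a = \<nu> / 2 * Ga + W / 4" and Eb: "energy \<nu> (trig_poly N b) = \<nu> / 2 * Gb + V / 4"
    by (simp_all add: energy_trig_poly a b Ga_def Gb_def W_def V_def)
  have "J = (\<Sum>k\<in>modes N. Re (fourier (\<lambda>y. nonlin (?a y)) k * cnj (b k - a k)))"
    unfolding J_def by (rule integral_mult_trig_poly[OF cont_nonlin])
  then have pairing: "J + \<nu> / 2 * (Gb - Ga) = - D"
    using scheme_pairing[OF pos(2) eq] by (simp only: Ga_def Gb_def D_def)
  have Z0: "0 \<le> Z" unfolding Z_def by (rule integral_cell_nonneg) simp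
  have "V / 4 \<le> W / 4 + J + 2 * P + 3/4 * Z"
  proof -
    \<comment> \<open>The integrands are written as linear combinations, the form to which \<open>integral_cell_linear\<close> applies.\<close>
    have "(LINT x:cell|lebesgue. 1/4 * ((trig_poly N b x)\<^sup>2 - 1)\<^sup>2 + 0 * ?e x)
        \<le> (LINT x:cell|lebesgue. 1 * (1/4 * ((?a x)\<^sup>2 - 1)\<^sup>2 + 1 * (nonlin (?a x) * ?e x))
            + 1 * (2 * ((?a x)\<^sup>2 * (?e x)\<^sup>2) + 3/4 * (?e x) ^ 4))"
    proof (rule integral_cell_mono)
      fix x
      have "trig_poly N b x = ?a x + ?e x" by (simp add: trig_poly_diff)
      then show "1/4 * ((trig_poly N b x)\<^sup>2 - 1)\<^sup>2 + 0 * ?e x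
          \<le> 1 * (1/4 * ((?a x)\<^sup>2 - 1)\<^sup>2 + 1 * (nonlin (?a x) * ?e x))
            + 1 * (2 * ((?a x)\<^sup>2 * (?e x)\<^sup>2) + 3/4 * (?e x) ^ 4)"
        using potential_increment[of "?a x" "?e x"] by simp
    qed (intro continuous_intros cont_nonlin)+
    also have "\<dots> = W / 4 + J + 2 * P + 3/4 * Z"
      by (subst integral_cell_linear, (intro continuous_intros cont_nonlin)+)+
        (simp add: W_def J_def P_def Z_def)
    finally show ?thesis
      by (subst (asm) integral_cell_linear, (intro continuous_intros)+) (simp add: V_def)
  qed
  moreover have "- (1/2 * W + 1/2 * P) \<le> J"
  proof -
    have "(LINT x:cell|lebesgue. (- 1/2) * ((?a x)\<^sup>2 - 1)\<^sup>2 + (- 1/2) * ((?a x)\<^sup>2 * (?e x)\<^sup>2)) \<le> J"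
      unfolding J_def
    proof (rule integral_cell_mono)
      fix x
      show "(- 1/2) * ((?a x)\<^sup>2 - 1)\<^sup>2 + (- 1/2) * ((?a x)\<^sup>2 * (?e x)\<^sup>2) \<le> nonlin (?a x) * ?e x"
        using nonlin_mult_ge[of "?a x" "?e x"] by simp
    qed (intro continuous_intros cont_nonlin)+
    then show ?thesis
      by (subst (asm) integral_cell_linear, (intro continuous_intros)+) (simp add: W_def P_def)
  qed
  moreover have "0 \<le> \<nu> / 2 * Ga" "0 \<le> \<nu> / 2 * Gb"
    using pos by (simp_all add: Ga_def Gb_def sum_nonneg laplace_symbol_nonneg)
  moreover have "\<nu> / 2 * Gb - \<nu> / 2 * Ga + J = - D"
    using pairing by (simp add: right_diff_distrib)
  ultimately have "D \<le> 2 * E + P / 2 \<and>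
      energy \<nu> (trig_poly N b) - energy \<nu> ?a \<le> 2 * P + 3/4 * Z - D"
    using E unfolding Ea Eb by (intro conjI) linarith+
  then have D_le: "D \<le> 2 * E + P / 2"
    and E_diff: "energy \<nu> (trig_poly N b) - energy \<nu> ?a \<le> 2 * P + 3/4 * Z - D"
    by blast+
  have "0 \<le> energy \<nu> ?a" using pos by (simp add: energy_nonneg)
  with E have E0: "0 \<le> E" by simp
  have "P \<le> sqrt (LINT x:cell|lebesgue. ((?a x)\<^sup>2)\<^sup>2) * sqrt (LINT x:cell|lebesgue. ((?e x)\<^sup>2)\<^sup>2)"
    unfolding P_def by (rule cauchy_schwarz_cell) (intro continuous_intros)+
  also have "\<dots> = sqrt (LINT x:cell|lebesgue. (?a x) ^ 4) * sqrt Z"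
    by (simp add: Z_def flip: power_mult)
  also have "\<dots> \<le> sqrt (8 * E + 2) * sqrt Z"
    using integral_L4_le_energy[OF a, of \<nu> N] pos E Z0 by (intro mult_right_mono) auto
  finally have "2 * P + 3/4 * (sqrt Z)\<^sup>2 \<le> D"
    using L4 Z0 by (intro absorption[OF D_le _ _ _ refl refl E0]) (auto simp: Z_def D_def)
  then show ?thesis using E_diff Z0 by simp
qed

section \<open>Energy decay in dimension below four\<close>

lemma trig_poly_real_mult: "trig_poly N (\<lambda>k. of_real r * c k) x = r * trig_poly N c x"
  by (simp only: trig_poly_def mult.assoc sum_distrib_left[symmetric] times_complex.sel
      Re_complex_of_real Im_complex_of_real mult_zero_left diff_zero)

text \<open>
  Both sides of the scheme are trigonometric polynomials with Hermitian coefficients, so the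
  pointwise identity can be compared frequency by frequency.
\<close>

lemma scheme_fourier:
  assumes "scheme_solution \<nu> \<tau> N u0 u"
    and a: "hermitian a" "u n = trig_poly N a" and b: "hermitian b" "u (Suc n) = trig_poly N b"
    and k: "k \<in> modes N"
  shows "(b k - a k) / of_real \<tau> = - of_real (\<nu> * (laplace_symbol k)\<^sup>2) * b k
        - of_real (laplace_symbol k) * fourier (\<lambda>y. nonlin (trig_poly N a y)) k"
proof -
  let ?f = "fourier (\<lambda>y. nonlin (trig_poly N a y))"
  let ?l = "\<lambda>k. of_real (- laplace_symbol k) :: complex"
  let ?L = "\<lambda>k. of_real (1 / \<tau>) * (b k - a k)"
  let ?R = "\<lambda>k. ?l k * ?f k - of_real \<nu> * (?l k * (?l k * b k))"
  have "(trig_poly N b x - trig_poly N a x) / \<tau> =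
      - \<nu> * laplacian (laplacian (trig_poly N b)) x
      + laplacian (proj N (\<lambda>y. nonlin (trig_poly N a y))) x" for x
    using assms(1) unfolding scheme_solution_def a(2)[symmetric] b(2)[symmetric] by blast
  then have "trig_poly N ?L x = trig_poly N ?R x" for x
    by (simp only: trig_poly_real_mult trig_poly_diff laplacian_trig_poly proj_eq_trig_poly) simp
  then have "trig_poly N ?L = trig_poly N ?R" by (rule ext)
  moreover have "hermitian ?L"
    by (intro hermitian_real_multiple hermitian_diff a b refl)
  moreover have "hermitian ?R"
    by (intro hermitian_real_multiple hermitian_diff a b hermitian_fourier refl)
      (simp_all add: laplace_symbol_uminus)
  ultimately have "?L k = ?R k"
    using trig_poly_cong_iff k by blast
  then show ?thesis by (simp add: power2_eq_square mult_ac)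
qed

text \<open>
  The value of \<open>\<epsilon>\<close> makes the constant of \<open>L4_le_dissipation\<close> equal to the \<open>\<eta>\<close> of \<open>absorption\<close>, with \<open>E\<close> the
  initial energy. That \<open>E\<close> bounds all later energies follows by induction from the decay itself.
\<close>

theorem energy_decay:
  fixes u :: "nat \<Rightarrow> real ^ 'd \<Rightarrow> real"
  assumes d: "CARD('d) < 4" and pos: "0 < \<nu>" "0 < \<tau>"
    and u: "scheme_solution \<nu> \<tau> N u0 u"
    and \<epsilon>: "\<epsilon> = 1 / (8 * sobolev_const TYPE('d) * sqrt (8 * energy \<nu> (u 0) + 2))"
    and \<tau>: "\<tau> \<le> \<epsilon> * (\<epsilon> * \<nu>) powr ((4 + real CARD('d)) / (4 - real CARD('d)))"
  shows "energy \<nu> (u (Suc n)) \<le> energy \<nu> (u n)"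
proof -
  define E where "E = energy \<nu> (u 0)"
  have "0 \<le> E" using pos by (simp add: E_def energy_nonneg)
  then have \<epsilon>_pos: "0 < \<epsilon>" by (simp add: \<epsilon> E_def sobolev_const_pos)
  have \<epsilon>_eq: "2 * sobolev_const TYPE('d) * \<epsilon> = 1 / (4 * sqrt (8 * E + 2))"
    using sobolev_const_pos[where 'd = 'd] by (simp add: \<epsilon> E_def field_simps)
  have rep: "\<exists>c. hermitian c \<and> u n = trig_poly N c" for n
  proof (cases n)
    case 0
    then show ?thesis
      using u hermitian_fourier proj_eq_trig_poly unfolding scheme_solution_def by metis
  next
    case (Suc m)
    then show ?thesis
      using u trig_space_imp_trig_poly unfolding scheme_solution_def by blast
  qed
  have step: "energy \<nu> (u (Suc n)) \<le> energy \<nu> (u n)" if "energy \<nu> (u n) \<le> E" for n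
  proof -
    obtain a b where a: "hermitian a" "u n = trig_poly N a" and b: "hermitian b" "u (Suc n) = trig_poly N b"
      using rep by meson
    note eq = scheme_fourier[OF u a b]
    have "0 \<in> modes N" by (simp add: mem_modes)
    from eq[OF this] pos have "b 0 - a 0 = 0" by simp
    then have "sqrt (LINT x:cell|lebesgue. (trig_poly N (\<lambda>k. b k - a k) x) ^ 4)
        \<le> 1 / (4 * sqrt (8 * E + 2)) * dissipation \<nu> \<tau> N (\<lambda>k. b k - a k)"
      unfolding \<epsilon>_eq[symmetric]
      by (intro L4_le_dissipation d hermitian_diff a b \<epsilon>_pos pos \<tau>)
    then show ?thesis
      using that unfolding a(2) b(2) by (intro energy_step[OF a(1) b(1) pos eq])
  qed
  have "energy \<nu> (u n) \<le> E" for n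
  proof (induction n)
    case (Suc n)
    then show ?case using step[of n] by simp
  qed (simp add: E_def)
  then show ?thesis by (rule step)
qed

text \<open>
  The factor of \<open>\<nu>\<close> in the step size restriction \<open>\<epsilon> (\<epsilon> \<nu>)\<^bsup>p\<^esup>\<close>, namely \<open>\<epsilon>\<^bsup>1+p\<^esup>\<close>.
\<close>

definition step_const :: "'d itself \<Rightarrow> real \<Rightarrow> real" where
  "step_const _ E = (1 / (8 * sobolev_const TYPE('d) * sqrt (8 * E + 2)))
     powr (1 + (4 + real CARD('d)) / (4 - real CARD('d)))"

lemma step_const_pos: "0 < E \<Longrightarrow> 0 < step_const TYPE('d::finite) E"
  using sobolev_const_pos[where 'd = 'd] by (simp add: step_const_def)

corollary energy_decay_step_const:
  fixes u :: "nat \<Rightarrow> real ^ 'd \<Rightarrow> real"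
  assumes "CARD('d) < 4" and pos: "0 < \<nu>" "0 < \<tau>" and "scheme_solution \<nu> \<tau> N u0 u"
    and \<tau>: "\<tau> \<le> step_const TYPE('d) (energy \<nu> (u 0))
      * \<nu> powr ((4 + real CARD('d)) / (4 - real CARD('d)))"
  shows "energy \<nu> (u (Suc n)) \<le> energy \<nu> (u n)"
proof (rule energy_decay[OF assms(1-4) refl])
  let ?\<epsilon> = "1 / (8 * sobolev_const TYPE('d) * sqrt (8 * energy \<nu> (u 0) + 2))"
  have "0 \<le> energy \<nu> (u 0)" using pos by (simp add: energy_nonneg)
  then have "0 < ?\<epsilon>" by (simp add: sobolev_const_pos)
  then show "\<tau> \<le> ?\<epsilon> * (?\<epsilon> * \<nu>) powr ((4 + real CARD('d)) / (4 - real CARD('d)))"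
    using \<tau> pos by (simp only: step_const_def powr_add powr_mult less_imp_le powr_one mult.assoc)
qed

text \<open>
  In dimensions \<open>1\<close>, \<open>2\<close>, \<open>3\<close> the exponent \<open>(4 + d) / (4 - d)\<close> evaluates to \<open>5/3\<close>, \<open>3\<close>, \<open>7\<close>.
\<close>

theorem theorem1p2:
  "\<exists>C1 C2 C3 :: real \<Rightarrow> real.
     (\<forall>E>0. C1 E > 0 \<and> C2 E > 0 \<and> C3 E > 0) \<and>
     (\<forall>\<nu> \<tau> N (u0 :: real ^ 1 \<Rightarrow> real) u L0.
        \<nu> > 0 \<and> \<tau> > 0 \<and> N \<ge> 2 \<and>
        u0 \<in> sobolev_H1 \<and> mean_zero u0 \<and> scheme_solution \<nu> \<tau> N u0 u \<and>
        Linf_norm (u 0) = ereal L0 \<and> L0 \<noteq> 0 \<and>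
        \<tau> \<le> min (8 * \<nu> / (9 * L0 ^ 4)) (C1 (energy \<nu> (u 0)) * \<nu> powr (5/3))
        \<longrightarrow> (\<forall>n. energy \<nu> (u (Suc n)) \<le> energy \<nu> (u n))) \<and>
     (\<forall>\<nu> \<tau> N (u0 :: real ^ 2 \<Rightarrow> real) u L0.
        \<nu> > 0 \<and> \<tau> > 0 \<and> N \<ge> 2 \<and>
        u0 \<in> sobolev_H1 \<and> mean_zero u0 \<and> scheme_solution \<nu> \<tau> N u0 u \<and>
        Linf_norm (u 0) = ereal L0 \<and> L0 \<noteq> 0 \<and>
        \<tau> \<le> min (8 * \<nu> / (9 * L0 ^ 4)) (C2 (energy \<nu> (u 0)) * \<nu> ^ 3)
        \<longrightarrow> (\<forall>n. energy \<nu> (u (Suc n)) \<le> energy \<nu> (u n))) \<and>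
     (\<forall>\<nu> \<tau> N (u0 :: real ^ 3 \<Rightarrow> real) u L0.
        \<nu> > 0 \<and> \<tau> > 0 \<and> N \<ge> 2 \<and>
        u0 \<in> sobolev_H1 \<and> mean_zero u0 \<and> scheme_solution \<nu> \<tau> N u0 u \<and>
        Linf_norm (u 0) = ereal L0 \<and> L0 \<noteq> 0 \<and>
        \<tau> \<le> min (8 * \<nu> / (9 * L0 ^ 4)) (C3 (energy \<nu> (u 0)) * \<nu> ^ 7)
        \<longrightarrow> (\<forall>n. energy \<nu> (u (Suc n)) \<le> energy \<nu> (u n)))"
proof -
  have one: "energy \<nu> (u (Suc n)) \<le> energy \<nu> (u n)"
    if "0 < \<nu>" "0 < \<tau>" "scheme_solution \<nu> \<tau> N u0 u"
      "\<tau> \<le> step_const TYPE(1) (energy \<nu> (u 0)) * \<nu> powr (5/3)"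
    for \<nu> \<tau> N n and u0 :: "real ^ 1 \<Rightarrow> real" and u
    using energy_decay_step_const[of \<nu> \<tau> N u0 u n] that by simp
  have two: "energy \<nu> (u (Suc n)) \<le> energy \<nu> (u n)"
    if "0 < \<nu>" "0 < \<tau>" "scheme_solution \<nu> \<tau> N u0 u"
      "\<tau> \<le> step_const TYPE(2) (energy \<nu> (u 0)) * \<nu> ^ 3"
    for \<nu> \<tau> N n and u0 :: "real ^ 2 \<Rightarrow> real" and u
    using energy_decay_step_const[of \<nu> \<tau> N u0 u n] that by simp
  have three: "energy \<nu> (u (Suc n)) \<le> energy \<nu> (u n)"
    if "0 < \<nu>" "0 < \<tau>" "scheme_solution \<nu> \<tau> N u0 u"
      "\<tau> \<le> step_const TYPE(3) (energy \<nu> (u 0)) * \<nu> ^ 7"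
    for \<nu> \<tau> N n and u0 :: "real ^ 3 \<Rightarrow> real" and u
    using energy_decay_step_const[of \<nu> \<tau> N u0 u n] that by simp
  show ?thesis
    by (rule exI[where x = "step_const TYPE(1)"], rule exI[where x = "step_const TYPE(2)"],
        rule exI[where x = "step_const TYPE(3)"])
      (auto simp: step_const_pos intro: one two three)
qed

end
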